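(* For every integer $d>1$, there exists a $d$-class symmetric association scheme in which exactly $d-2$ of the relations $A_1,\dots,A_d$ are strongly regular graphs of Latin square type.
   Context: A $d$-class (symmetric) association scheme is a set of $d+1$ nonzero symmetric $01$-matrices $\{A_0=I,A_1,\dots,A_d\}$ of the same size $v$ that sum to the all-ones matrix $J$ and whose span is an algebra under ordinary matrix multiplication. The matrices $A_1,\dots,A_d$ are identified with the graphs of which they are adjacency matrices, and are called the relations of the scheme. A graph is strongly regular if it is one of the (non-identity) relations of a $2$-class association scheme. Its restricted eigenvalues are its eigenvalues on the nontrivial common eigenspaces of that $2$-class scheme (the ones other than the span of the all-ones vector). A strongly regular graph on $v$ vertices with valency $k$ is of Latin square type if $v=n^2$, $k=t(n-1)$, and its restricted eigenvalues are $n-t$ and $-t$, for some positive integers $n$ and $t$. *)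

theory Defs
  imports Complex_Main "Jordan_Normal_Form.Matrix"
begin

definition all_ones_mat :: "nat \<Rightarrow> real mat" where
  "all_ones_mat v = mat v v (\<lambda>_. 1)"

definition all_ones_vec :: "nat \<Rightarrow> real vec" where
  "all_ones_vec v = vec v (\<lambda>_. 1)"

definition lin_comb :: "nat \<Rightarrow> nat \<Rightarrow> (nat \<Rightarrow> real mat) \<Rightarrow> (nat \<Rightarrow> real) \<Rightarrow> real mat" where
  "lin_comb d v A c = mat v v (\<lambda>(r, s). \<Sum>i\<le>d. c i * A i $$ (r, s))"

definition scheme_span :: "nat \<Rightarrow> nat \<Rightarrow> (nat \<Rightarrow> real mat) \<Rightarrow> real mat set" where
  "scheme_span d v A = range (lin_comb d v A)"

text \<open>A scheme is given by the indexed family \<open>A 0, \<dots>, A d\<close>; the values of \<open>A\<close> at indices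
  above \<open>d\<close> are irrelevant. The span is a linear subspace by construction, so it is an algebra
  as soon as it is closed under multiplication.\<close>

definition assoc_scheme :: "nat \<Rightarrow> nat \<Rightarrow> (nat \<Rightarrow> real mat) \<Rightarrow> bool" where
  "assoc_scheme d v A \<longleftrightarrow>
     inj_on A {..d} \<and>
     A 0 = 1\<^sub>m v \<and>
     (\<forall>i\<le>d. A i \<in> carrier_mat v v \<and> A i \<noteq> 0\<^sub>m v v \<and>
        elements_mat (A i) \<subseteq> {0, 1} \<and> transpose_mat (A i) = A i) \<and>
     lin_comb d v A (\<lambda>_. 1) = all_ones_mat v \<and>
     (\<forall>M \<in> scheme_span d v A. \<forall>N \<in> scheme_span d v A. M * N \<in> scheme_span d v A)"

text \<open>The common eigenspaces are the nonzero maximal subspaces on which every \<open>A i\<close> acts as a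
  scalar \<open>\<theta> i\<close>.\<close>

definition common_eigenspaces :: "nat \<Rightarrow> nat \<Rightarrow> (nat \<Rightarrow> real mat) \<Rightarrow> real vec set set" where
  "common_eigenspaces d v A =
     {E. \<exists>\<theta>. E = {x \<in> carrier_vec v. \<forall>i\<le>d. A i *\<^sub>v x = \<theta> i \<cdot>\<^sub>v x} \<and> E \<noteq> {0\<^sub>v v}}"

definition nontrivial_common_eigenspaces ::
    "nat \<Rightarrow> nat \<Rightarrow> (nat \<Rightarrow> real mat) \<Rightarrow> real vec set set" where
  "nontrivial_common_eigenspaces d v A =
     common_eigenspaces d v A - {range (\<lambda>c. c \<cdot>\<^sub>v all_ones_vec v)}"

text \<open>Graphs are identified with their adjacency matrices. The 2-class scheme containing a
  strongly regular graph \<open>M\<close> consists of \<open>I\<close>, \<open>M\<close> and \<open>J - I - M\<close>, so it is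
  determined by \<open>M\<close> up to the order of its two non-identity relations.\<close>

definition strongly_regular_in :: "nat \<Rightarrow> (nat \<Rightarrow> real mat) \<Rightarrow> real mat \<Rightarrow> bool" where
  "strongly_regular_in v A M \<longleftrightarrow> assoc_scheme 2 v A \<and> M \<in> A ` {1..2}"

definition restricted_eigenvalues :: "nat \<Rightarrow> (nat \<Rightarrow> real mat) \<Rightarrow> real mat \<Rightarrow> real set" where
  "restricted_eigenvalues v A M =
     {\<theta>. \<exists>E \<in> nontrivial_common_eigenspaces 2 v A. \<forall>x \<in> E. M *\<^sub>v x = \<theta> \<cdot>\<^sub>v x}"

definition has_valency :: "nat \<Rightarrow> real mat \<Rightarrow> nat \<Rightarrow> bool" where
  "has_valency v M k \<longleftrightarrow> (\<forall>r<v. card {s. s < v \<and> M $$ (r, s) = 1} = k)"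

definition latin_square_type :: "nat \<Rightarrow> real mat \<Rightarrow> bool" where
  "latin_square_type v M \<longleftrightarrow>
     (\<exists>A. strongly_regular_in v A M \<and>
       (\<exists>n t. n > 0 \<and> t > 0 \<and> v = n\<^sup>2 \<and> has_valency v M (t * (n - 1)) \<and>
         restricted_eigenvalues v A M = {real n - real t, - real t}))"

end

theory Submission
  imports Defs "HOL-Library.Product_Plus" "HOL-Library.Z2" "HOL-Algebra.Algebraic_Closure_Type"
begin

text \<open>For \<open>d = 2\<close> every two-class scheme on eight vertices will do, because graphs of Latin square type
have a square number of vertices. A subgroup of \<open>(\<int>/2)\<^sup>3\<close> gives one (\<open>subgroup_scheme\<close>).

For \<open>d = m + 3\<close> the scheme consists of Cayley graphs on \<open>V = F\<^sup>4\<close>, where \<open>F\<close> is a finite field of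
characteristic 2 with at least \<open>m\<close> elements that contains a root \<open>\<alpha>\<close> of \<open>x\<^sup>3 = x + 1\<close>, and hence
the field \<open>K\<close> with eight elements. Let \<open>Q(x) = x\<^sub>1 x\<^sub>4 + x\<^sub>2 x\<^sub>3\<close>, let \<open>\<psi>\<close> be a nontrivial additive character of
\<open>F\<close> with values \<open>\<plusminus>1\<close>, put \<open>\<phi>\<^sub>l(x) = \<psi>(l Q(x))\<close>, and let \<open>N = |F|\<^sup>2\<close>, so that \<open>|V| = N\<^sup>2\<close>.
The nonzero vectors with \<open>\<phi>\<^sub>1 = 1\<close> are divided into \<open>m\<close> totally singular planes
\<open>{(a, b, k a, k b)}\<close>, called lines below because their cosets are lines of an affine plane of order
\<open>N\<close>, and one remaining class. These \<open>m + 1\<close> classes have Latin square type. The vectors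
with \<open>\<phi>\<^sub>1 = -1\<close> are divided into the set \<open>R\<^sub>1\<close> of those \<open>x\<close> for which \<open>\<lambda> \<mapsto> \<phi>\<^sub>\<lambda>(x)\<close> is the trace
character of \<open>K\<close>, and the set \<open>R\<^sub>2\<close> of the others. These two classes are not even strongly regular.

The reason why this partition is a scheme is that completing the square gives
\<open>\<phi>\<^sub>l * \<phi>\<^sub>m = N \<phi>\<^sub>c\<close> with \<open>1/c = 1/l + 1/m\<close> (\<open>conv_phi_phi\<close>), while \<open>\<phi>\<^sub>l * \<phi>\<^sub>l = N\<^sup>2 \<delta>\<^sub>0\<close>. The set
\<open>R\<^sub>1\<close> enters only through the sum \<open>H\<close> of the six functions \<open>\<phi>\<^sub>\<lambda>\<close> with \<open>\<lambda> \<in> K\<close>, \<open>\<lambda> \<noteq> 0, 1\<close>, each with the sign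
of its trace. Inversion maps the elements of \<open>K\<close> other than \<open>0\<close> and \<open>1\<close> of trace 0 to those of trace 1 and conversely, and
this makes \<open>\<phi>\<^sub>1 * H\<close> and \<open>H * H\<close> combinations of \<open>\<delta>\<^sub>0\<close>, \<open>\<phi>\<^sub>1\<close> and \<open>H\<close> again (\<open>conv_phi_1_H\<close>, \<open>conv_H_H\<close>).
Together with the convolutions of the lines this is the complete multiplication table (\<open>basis_table\<close>).

A class \<open>D\<close> has Latin square type because \<open>e = 1\<^sub>D + t \<delta>\<^sub>0\<close> satisfies \<open>e * e = N e + const\<close>
(\<open>latin_square_type_cayley\<close>). The class \<open>R\<^sub>1\<close> is not strongly regular because \<open>R\<^sub>1 * R\<^sub>1\<close> takes different
values on \<open>R\<^sub>2\<close> and on the class that remains of \<open>\<phi>\<^sub>1 = 1\<close>, although neither meets \<open>R\<^sub>1\<close>. The argument for \<open>R\<^sub>2\<close> is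
the same with \<open>R\<^sub>1\<close> and \<open>R\<^sub>2\<close> exchanged (\<open>strongly_regular_conv_eq\<close>).\<close>

section \<open>Cayley matrices of elementary abelian 2-groups\<close>

(* The dollar sign is the index operation of vectors and matrices here. *)
no_notation fps_nth (infixl \<open>$\<close> 75)

text \<open>The group is a subset of a type, so that its size can depend on a variable. As every element is its
own inverse, \<open>x + y\<close> serves as the difference of \<open>x\<close> and \<open>y\<close> and all Cayley matrices are symmetric.\<close>

locale boolean_group =
  fixes V :: "'g::ab_group_add set"
  assumes finite_V: "finite V"
    and zero_mem: "0 \<in> V"
    and add_mem: "x \<in> V \<Longrightarrow> y \<in> V \<Longrightarrow> x + y \<in> V"
    and double: "x \<in> V \<Longrightarrow> x + x = 0"
begin

definition enum :: "nat \<Rightarrow> 'g" where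
  "enum = (SOME e. bij_betw e {..<card V} V)"

definition cayley :: "('g \<Rightarrow> real) \<Rightarrow> real mat" where
  "cayley f = mat (card V) (card V) (\<lambda>(r, s). f (enum r + enum s))"

text \<open>Convolution, again with \<open>y + z\<close> in the place of \<open>z - y\<close>.\<close>

definition conv :: "('g \<Rightarrow> real) \<Rightarrow> ('g \<Rightarrow> real) \<Rightarrow> 'g \<Rightarrow> real" where
  "conv f g z = (\<Sum>y\<in>V. f y * g (y + z))"

text \<open>A partition of the group is given by the numbering \<open>cls\<close> of its blocks.\<close>

definition class_function :: "('g \<Rightarrow> nat) \<Rightarrow> ('g \<Rightarrow> real) \<Rightarrow> bool" where
  "class_function cls f \<longleftrightarrow> (\<exists>c. \<forall>x\<in>V. f x = c (cls x))"

lemma bij_enum: "bij_betw enum {..<card V} V"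
proof -
  have "\<exists>e. bij_betw e {..<card V} V"
    using ex_bij_betw_nat_finite[OF finite_V] by (simp add: atLeast0LessThan)
  then show ?thesis unfolding enum_def by (rule someI_ex)
qed

lemma enum_mem: "r < card V \<Longrightarrow> enum r \<in> V"
  using bij_enum by (auto simp: bij_betw_def)

lemma enum_surj: "x \<in> V \<Longrightarrow> \<exists>r<card V. enum r = x"
  using bij_enum unfolding bij_betw_def by (metis imageE lessThan_iff)

lemma card_V_pos: "card V > 0"
  using finite_V zero_mem by (auto simp: card_gt_0_iff)

lemma add_eq_0_iff: "x \<in> V \<Longrightarrow> y \<in> V \<Longrightarrow> x + y = 0 \<longleftrightarrow> x = y"
  by (metis add_left_cancel double)

lemma add_cancel: "x \<in> V \<Longrightarrow> x + (x + y) = y"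
  by (metis add.assoc add_0 double)

lemma enum_add_eq_0_iff: "r < card V \<Longrightarrow> s < card V \<Longrightarrow> enum r + enum s = 0 \<longleftrightarrow> r = s"
  using bij_enum add_eq_0_iff[OF enum_mem enum_mem]
  by (auto simp: bij_betw_def inj_on_def)

lemma bij_translate: "z \<in> V \<Longrightarrow> bij_betw ((+) z) V V"
  by (rule bij_betwI[where g = "(+) z"]) (auto simp: add_mem add_cancel)

lemma sum_translate: "z \<in> V \<Longrightarrow> (\<Sum>y\<in>V. f (z + y)) = (\<Sum>y\<in>V. f y)"
  using sum.reindex_bij_betw[OF bij_translate, of z f] by simp

lemma sum_enum: "(\<Sum>k<card V. f (enum k)) = (\<Sum>y\<in>V. f y)"
  by (rule sum.reindex_bij_betw[OF bij_enum])

lemma cayley_carrier [simp]: "cayley f \<in> carrier_mat (card V) (card V)"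
  by (simp add: cayley_def)

lemma cayley_dim [simp]: "dim_row (cayley f) = card V" "dim_col (cayley f) = card V"
  by (simp_all add: cayley_def)

lemma cayley_index [simp]:
  "r < card V \<Longrightarrow> s < card V \<Longrightarrow> cayley f $$ (r, s) = f (enum r + enum s)"
  by (simp add: cayley_def)

lemma transpose_cayley [simp]: "transpose_mat (cayley f) = cayley f"
  by (rule eq_matI) (auto simp: add.commute)

lemma cayley_cong: "(\<And>x. x \<in> V \<Longrightarrow> f x = g x) \<Longrightarrow> cayley f = cayley g"
  by (rule eq_matI) (auto simp: add_mem enum_mem)

lemma cayley_delta: "cayley (\<lambda>x. of_bool (x = 0)) = 1\<^sub>m (card V)"
  by (rule eq_matI) (auto simp: enum_add_eq_0_iff)

text \<open>Every difference occurs in the first row, so a function on the group can be read off its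
  Cayley matrix.\<close>

lemma cayley_inj: "cayley f = cayley g \<Longrightarrow> x \<in> V \<Longrightarrow> f x = g x"
proof -
  assume eq: "cayley f = cayley g" and x: "x \<in> V"
  obtain r s where r: "r < card V" "enum r = 0" and s: "s < card V" "enum s = x"
    using enum_surj[OF zero_mem] enum_surj[OF x] by auto
  have "cayley f $$ (r, s) = cayley g $$ (r, s)" using eq by simp
  then show "f x = g x" using r s by simp
qed

text \<open>The substitution \<open>k = r + y\<close> turns the sum defining a matrix product into a convolution;
  no inverse is needed because every element of the group is its own inverse.\<close>

lemma cayley_mult: "cayley f * cayley g = cayley (conv f g)"
proof (rule eq_matI)
  fix r s assume "r < dim_row (cayley (conv f g))" "s < dim_col (cayley (conv f g))"
  then have r: "r < card V" and s: "s < card V" by auto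
  have "(cayley f * cayley g) $$ (r, s) = (\<Sum>k<card V. f (enum r + enum k) * g (enum k + enum s))"
    using r s by (simp add: scalar_prod_def atLeast0LessThan)
  also have "\<dots> = (\<Sum>y\<in>V. f (enum r + y) * g (y + enum s))"
    by (rule sum_enum)
  also have "\<dots> = (\<Sum>y\<in>V. f (enum r + (enum r + y)) * g ((enum r + y) + enum s))"
    by (rule sum_translate[OF enum_mem[OF r], symmetric])
  also have "\<dots> = (\<Sum>y\<in>V. f y * g (y + (enum r + enum s)))"
  proof (rule sum.cong[OF refl])
    fix y
    have "enum r + y + enum s = y + (enum r + enum s)" by (simp add: add_ac)
    then show "f (enum r + (enum r + y)) * g (enum r + y + enum s) = f y * g (y + (enum r + enum s))"
      by (simp only: add_cancel[OF enum_mem[OF r]])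
  qed
  finally show "(cayley f * cayley g) $$ (r, s) = cayley (conv f g) $$ (r, s)"
    using r s by (simp add: conv_def)
qed auto

lemma conv_cong:
  "(\<And>x. x \<in> V \<Longrightarrow> f x = f' x) \<Longrightarrow> (\<And>x. x \<in> V \<Longrightarrow> g x = g' x) \<Longrightarrow> z \<in> V \<Longrightarrow>
    conv f g z = conv f' g' z"
  unfolding conv_def by (rule sum.cong) (auto simp: add_mem)

lemma conv_commute:
  assumes z: "z \<in> V"
  shows "conv f g z = conv g f z"
proof -
  have "conv f g z = (\<Sum>y\<in>V. f (z + y) * g ((z + y) + z))"
    unfolding conv_def by (rule sum_translate[OF z, symmetric])
  also have "\<dots> = conv g f z"
    unfolding conv_def
  proof (rule sum.cong[OF refl])
    fix y
    have "(z + y) + z = y" using add_cancel[OF z, of y] by (simp add: add_ac)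
    then show "f (z + y) * g (z + y + z) = g y * f (y + z)"
      by (metis add.commute mult.commute)
  qed
  finally show ?thesis .
qed

lemma conv_add_left: "conv (\<lambda>x. f x + g x) h z = conv f h z + conv g h z"
  by (simp add: conv_def sum.distrib algebra_simps)

lemma conv_add_right: "conv h (\<lambda>x. f x + g x) z = conv h f z + conv h g z"
  by (simp add: conv_def sum.distrib algebra_simps)

lemma conv_diff_left: "conv (\<lambda>x. f x - g x) h z = conv f h z - conv g h z"
  by (simp add: conv_def sum_subtractf algebra_simps)

lemma conv_diff_right: "conv h (\<lambda>x. f x - g x) z = conv h f z - conv h g z"
  by (simp add: conv_def sum_subtractf algebra_simps)

lemma conv_scale_left: "conv (\<lambda>x. a * f x) h z = a * conv f h z"
  by (simp add: conv_def sum_distrib_left algebra_simps)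

lemma conv_scale_right: "conv h (\<lambda>x. a * f x) z = a * conv h f z"
  by (simp add: conv_def sum_distrib_left algebra_simps)

lemma conv_sum_left: "conv (\<lambda>x. \<Sum>i\<in>I. f i x) h z = (\<Sum>i\<in>I. conv (f i) h z)"
  unfolding conv_def sum_distrib_right by (rule sum.swap)

lemma conv_sum_right: "conv h (\<lambda>x. \<Sum>i\<in>I. f i x) z = (\<Sum>i\<in>I. conv h (f i) z)"
  unfolding conv_def sum_distrib_left by (rule sum.swap)

lemmas conv_linear = conv_add_left conv_add_right conv_diff_left conv_diff_right
  conv_scale_left conv_scale_right conv_sum_left conv_sum_right

lemma conv_delta_left: "conv (\<lambda>x. of_bool (x = 0)) f z = f z"
proof -
  have "conv (\<lambda>x. of_bool (x = 0)) f z = (\<Sum>y\<in>V. if y = 0 then f z else 0)"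
    unfolding conv_def by (rule sum.cong) auto
  then show ?thesis using finite_V zero_mem by simp
qed

lemma conv_delta_right: "z \<in> V \<Longrightarrow> conv f (\<lambda>x. of_bool (x = 0)) z = f z"
  using conv_commute conv_delta_left by metis

lemma conv_const_right: "conv f (\<lambda>_. a) z = a * (\<Sum>y\<in>V. f y)"
  by (simp add: conv_def sum_distrib_left mult.commute)

lemma conv_const_left: "z \<in> V \<Longrightarrow> conv (\<lambda>_. a) f z = a * (\<Sum>y\<in>V. f y)"
  using conv_commute conv_const_right by metis

text \<open>For \<open>y\<close> in the subgroup, \<open>y + z\<close> is in it exactly when \<open>z\<close> is.\<close>

lemma conv_subgroup:
  assumes "H \<subseteq> V" and "\<And>x y. x \<in> H \<Longrightarrow> y \<in> H \<Longrightarrow> x + y \<in> H" and z: "z \<in> V"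
  shows "conv (\<lambda>x. of_bool (x \<in> H)) (\<lambda>x. of_bool (x \<in> H)) z = real (card H) * of_bool (z \<in> H)"
proof -
  have "y + z \<in> H \<longleftrightarrow> z \<in> H" if "y \<in> H" for y
    using assms add_cancel[of y z] that by (metis subsetD)
  then have "conv (\<lambda>x. of_bool (x \<in> H)) (\<lambda>x. of_bool (x \<in> H)) z =
      (\<Sum>y\<in>V. of_bool (y \<in> H) * of_bool (z \<in> H))"
    unfolding conv_def by (intro sum.cong) auto
  also have "\<dots> = real (card H) * of_bool (z \<in> H)"
    using finite_V assms(1) by (simp add: sum_distrib_right[symmetric] Int_absorb1 Int_def[symmetric])
  finally show ?thesis .
qed

lemma class_functionI: "(\<And>x. x \<in> V \<Longrightarrow> f x = c (cls x)) \<Longrightarrow> class_function cls f"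
  unfolding class_function_def by blast

lemma class_function_cong:
  "class_function cls f \<Longrightarrow> (\<And>x. x \<in> V \<Longrightarrow> f x = g x) \<Longrightarrow> class_function cls g"
  unfolding class_function_def by metis

lemma class_function_const: "class_function cls (\<lambda>_. a)"
  by (rule class_functionI[where c = "\<lambda>_. a"]) simp

lemma class_function_add:
  "class_function cls f \<Longrightarrow> class_function cls g \<Longrightarrow> class_function cls (\<lambda>x. f x + g x)"
  unfolding class_function_def by (elim exE, rule_tac x = "\<lambda>k. c k + ca k" in exI) simp

lemma class_function_diff:
  "class_function cls f \<Longrightarrow> class_function cls g \<Longrightarrow> class_function cls (\<lambda>x. f x - g x)"
  unfolding class_function_def by (elim exE, rule_tac x = "\<lambda>k. c k - ca k" in exI) simp

lemma class_function_scale: "class_function cls f \<Longrightarrow> class_function cls (\<lambda>x. a * f x)"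
  unfolding class_function_def by (elim exE, rule_tac x = "\<lambda>k. a * c k" in exI) simp

lemma class_function_sum:
  assumes "\<And>i. i \<in> I \<Longrightarrow> class_function cls (f i)"
  shows "class_function cls (\<lambda>x. \<Sum>i\<in>I. f i x)"
proof -
  obtain c where "\<And>i x. i \<in> I \<Longrightarrow> x \<in> V \<Longrightarrow> f i x = c i (cls x)"
    using assms unfolding class_function_def by metis
  then show ?thesis
    by (intro class_functionI[where c = "\<lambda>k. \<Sum>i\<in>I. c i k"]) (simp cong: sum.cong)
qed

lemmas class_function_intros = class_function_const class_function_add class_function_diff
  class_function_scale class_function_sum

text \<open>A partition of the group with \<open>{0}\<close> as a block gives a scheme as soon as the functions
  that are constant on the blocks are closed under convolution: they are the Bose-Mesner algebra.\<close>

theorem cayley_scheme: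
  assumes onto: "cls ` V = {..d}"
    and zero: "\<And>x. x \<in> V \<Longrightarrow> cls x = 0 \<longleftrightarrow> x = 0"
    and closed: "\<And>f g. class_function cls f \<Longrightarrow> class_function cls g \<Longrightarrow> class_function cls (conv f g)"
  shows "assoc_scheme d (card V) (\<lambda>i. cayley (\<lambda>x. of_bool (cls x = i)))"
    (is "assoc_scheme d _ ?A")
proof -
  have comb: "lin_comb d (card V) ?A c = cayley (\<lambda>x. c (cls x))" for c
  proof (rule eq_matI)
    fix r s assume "r < dim_row (cayley (\<lambda>x. c (cls x)))" "s < dim_col (cayley (\<lambda>x. c (cls x)))"
    then have rs: "r < card V" "s < card V" by auto
    have "cls (enum r + enum s) \<le> d"
      using onto add_mem[OF enum_mem[OF rs(1)] enum_mem[OF rs(2)]] by auto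
    then show "lin_comb d (card V) ?A c $$ (r, s) = cayley (\<lambda>x. c (cls x)) $$ (r, s)"
      using rs by (simp add: lin_comb_def if_distrib[of "\<lambda>y. _ * y"] of_bool_def cong: if_cong)
  qed (auto simp: lin_comb_def)
  have witness: "\<exists>x\<in>V. cls x = i" if "i \<le> d" for i
    using onto that by (metis atMost_iff imageE)
  have inj: "inj_on ?A {..d}"
  proof (rule inj_onI)
    fix i j assume i: "i \<in> {..d}" and eq: "?A i = ?A j"
    obtain x where x: "x \<in> V" "cls x = i" using witness i by auto
    show "i = j" using cayley_inj[OF eq x(1)] x(2) by (simp split: if_splits)
  qed
  have nonzero: "?A i \<noteq> 0\<^sub>m (card V) (card V)" if "i \<le> d" for i
  proof
    assume eq: "?A i = 0\<^sub>m (card V) (card V)"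
    have "0\<^sub>m (card V) (card V) = cayley (\<lambda>_. 0)" by (rule eq_matI) auto
    then have "?A i = cayley (\<lambda>_. 0)" using eq by simp
    moreover obtain x where "x \<in> V" "cls x = i" using witness \<open>i \<le> d\<close> by auto
    ultimately show False using cayley_inj[of _ "\<lambda>_. 0" x] by fastforce
  qed
  have zero_one: "elements_mat (?A i) \<subseteq> {0, 1}" for i
    by (auto simp: elements_mat_def)
  have "?A 0 = 1\<^sub>m (card V)"
    using cayley_cong[of "\<lambda>x. of_bool (cls x = 0)" "\<lambda>x. of_bool (x = 0)"] zero cayley_delta by simp
  moreover have "lin_comb d (card V) ?A (\<lambda>_. 1) = all_ones_mat (card V)"
    unfolding comb all_ones_mat_def by (rule eq_matI) auto
  moreover have "M * N \<in> scheme_span d (card V) ?A"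
    if M: "M \<in> scheme_span d (card V) ?A" and N: "N \<in> scheme_span d (card V) ?A" for M N
  proof -
    obtain a b where "M = cayley (\<lambda>x. a (cls x))" "N = cayley (\<lambda>x. b (cls x))"
      using M N by (auto simp: scheme_span_def comb)
    then have MN: "M * N = cayley (conv (\<lambda>x. a (cls x)) (\<lambda>x. b (cls x)))"
      by (simp add: cayley_mult)
    have "class_function cls (conv (\<lambda>x. a (cls x)) (\<lambda>x. b (cls x)))"
      by (intro closed class_functionI) auto
    then obtain c where "\<And>x. x \<in> V \<Longrightarrow> conv (\<lambda>x. a (cls x)) (\<lambda>x. b (cls x)) x = c (cls x)"
      unfolding class_function_def by blast
    then have "M * N = lin_comb d (card V) ?A c"
      unfolding MN comb by (rule cayley_cong)
    then show ?thesis by (simp add: scheme_span_def)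
  qed
  ultimately show ?thesis
    unfolding assoc_scheme_def using inj nonzero zero_one by auto
qed

text \<open>Bilinearity and commutativity reduce closure under convolution to a set of functions that
  spans the class functions.\<close>

lemma conv_closed_if_spanning:
  fixes I :: "nat set"
  assumes span: "\<And>f. class_function cls f \<Longrightarrow> \<exists>c. \<forall>x\<in>V. f x = (\<Sum>i\<in>I. c i * b i x)"
    and table: "\<And>i j. i \<in> I \<Longrightarrow> j \<in> I \<Longrightarrow> i \<le> j \<Longrightarrow> class_function cls (conv (b i) (b j))"
    and f: "class_function cls f" and g: "class_function cls g"
  shows "class_function cls (conv f g)"
proof -
  obtain c c' where c: "\<And>x. x \<in> V \<Longrightarrow> f x = (\<Sum>i\<in>I. c i * b i x)"
    and c': "\<And>x. x \<in> V \<Longrightarrow> g x = (\<Sum>i\<in>I. c' i * b i x)"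
    using span[OF f] span[OF g] by blast
  have table': "class_function cls (conv (b i) (b j))" if "i \<in> I" "j \<in> I" for i j
  proof (cases "i \<le> j")
    case True
    then show ?thesis using table that by simp
  next
    case False
    then have "class_function cls (conv (b j) (b i))" using table that by simp
    then show ?thesis by (rule class_function_cong) (rule conv_commute)
  qed
  have "class_function cls (\<lambda>z. \<Sum>i\<in>I. \<Sum>j\<in>I. c i * (c' j * conv (b i) (b j) z))"
    by (intro class_function_intros table')
  moreover have "(\<Sum>i\<in>I. \<Sum>j\<in>I. c i * (c' j * conv (b i) (b j) z)) = conv f g z" if "z \<in> V" for z
  proof -
    have "conv f g z = conv (\<lambda>x. \<Sum>i\<in>I. c i * b i x) (\<lambda>x. \<Sum>i\<in>I. c' i * b i x) z"
      by (rule conv_cong[OF c c' that])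
    then show ?thesis by (simp add: conv_linear sum_distrib_left)
  qed
  ultimately show ?thesis by (rule class_function_cong)
qed

text \<open>The cosets of a proper nontrivial subgroup yield a disjoint union of complete graphs and its
complement. The functions \<open>\<delta>\<^sub>0\<close>, \<open>1\<close> and \<open>1\<^sub>H\<close> span the class functions.\<close>

lemma subgroup_scheme:
  assumes H: "H \<subseteq> V" "0 \<in> H" "\<And>x y. x \<in> H \<Longrightarrow> y \<in> H \<Longrightarrow> x + y \<in> H"
    and proper: "H \<noteq> {0}" "H \<noteq> V"
  shows "\<exists>A. assoc_scheme 2 (card V) A"
proof -
  define cls :: "'g \<Rightarrow> nat" where "cls x = (if x = 0 then 0 else if x \<in> H then 1 else 2)" for x
  define b :: "nat \<Rightarrow> 'g \<Rightarrow> real" where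
    "b i = (if i = 0 then (\<lambda>x. of_bool (x = 0)) else if i = 1 then (\<lambda>_. 1) else (\<lambda>x. of_bool (x \<in> H)))" for i
  have b_simps: "b 0 = (\<lambda>x. of_bool (x = 0))" "b 1 = (\<lambda>_. 1)" "b 2 = (\<lambda>x. of_bool (x \<in> H))"
    by (simp_all add: b_def)
  have b_cls: "class_function cls (b i)" for i
    by (rule class_functionI[where c = "\<lambda>k. if i = 0 then of_bool (k = 0) else if i = 1 then 1 else of_bool (k < 2)"])
      (use H in \<open>auto simp: b_def cls_def\<close>)
  have "assoc_scheme 2 (card V) (\<lambda>i. cayley (\<lambda>x. of_bool (cls x = i)))"
  proof (rule cayley_scheme)
    obtain x y where "x \<in> H" "x \<noteq> 0" "y \<in> V" "y \<notin> H" using H proper by blast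
    then have "cls 0 = 0" "cls x = 1" "cls y = 2" using H by (auto simp: cls_def)
    then have "{0, 1, 2} \<subseteq> cls ` V"
      using zero_mem \<open>y \<in> V\<close> subsetD[OF H(1) \<open>x \<in> H\<close>] by (auto intro: rev_image_eqI)
    moreover have "{..2} = {0, 1, 2 :: nat}" by auto
    moreover have "cls ` V \<subseteq> {..2}" by (auto simp: cls_def)
    ultimately show "cls ` V = {..2}" by (metis subset_antisym)
    show "class_function cls (conv f g)" if fg: "class_function cls f" "class_function cls g" for f g
    proof (rule conv_closed_if_spanning[OF _ _ fg, where I = "{0, 1, 2}" and b = b])
      fix f assume "class_function cls f"
      then obtain k where k: "\<And>x. x \<in> V \<Longrightarrow> f x = k (cls x)"
        by (auto simp: class_function_def)
      show "\<exists>h. \<forall>x\<in>V. f x = (\<Sum>i\<in>{0, 1, 2}. h i * b i x)"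
        by (rule exI[of _ "\<lambda>i. if i = 0 then k 0 - k 1 else if i = 1 then k 2 else k 1 - k 2"])
          (use H in \<open>auto simp: k b_def cls_def\<close>)
    next
      fix i j :: nat assume "i \<in> {0, 1, 2}" "j \<in> {0, 1, 2}" "i \<le> j"
      then consider "i = 0" | "i = 1" | "i = 2" "j = 2" by fastforce
      then show "class_function cls (conv (b i) (b j))"
      proof cases
        case 1
        show ?thesis
          by (rule class_function_cong[OF b_cls[of j]]) (simp only: 1 b_simps conv_delta_left)
      next
        case 2
        show ?thesis
          by (rule class_function_cong[OF class_function_const]) (simp only: 2 b_simps conv_const_left)
      next
        case 3
        show ?thesis
          by (rule class_function_cong[OF class_function_scale[OF b_cls[of 2], of "card H"]])
            (simp only: 3 b_simps conv_subgroup[OF H(1,3)])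
      qed
    qed
  qed (simp add: cls_def)
  then show ?thesis by blast
qed

section \<open>Strong regularity and Latin square type of Cayley graphs\<close>

lemma cayley_mult_vec_index:
  assumes "x \<in> carrier_vec (card V)" "r < card V"
  shows "(cayley f *\<^sub>v x) $ r = (\<Sum>s<card V. f (enum r + enum s) * x $ s)"
  using assms by (simp add: scalar_prod_def atLeast0LessThan)

text \<open>The square of the adjacency matrix of a strongly regular graph is a combination of \<open>I\<close>, of the matrix
itself and of the third relation. Off the diagonal and outside the graph it is therefore constant.\<close>

lemma strongly_regular_conv_eq:
  assumes srg: "strongly_regular_in (card V) A (cayley f)"
    and x: "x \<in> V" "x \<noteq> 0" "f x = 0" and y: "y \<in> V" "y \<noteq> 0" "f y = 0"
  shows "conv f f x = conv f f y"
proof -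
  have scheme: "assoc_scheme 2 (card V) A" and "cayley f \<in> A ` {1..2}"
    using srg by (auto simp: strongly_regular_in_def)
  then obtain k where k: "k \<in> {1..2}" "A k = cayley f" by auto
  \<comment> \<open>\<open>k\<close> numbers the given graph and \<open>l\<close> its complement.\<close>
  define l where "l = 3 - k"
  have kl: "{..2} = {0, k, l}" "k \<noteq> 0" "l \<noteq> 0" "k \<noteq> l"
  proof -
    have "k = 1 \<or> k = 2" using k(1) by auto
    then show "{..2} = {0, k, l}" "k \<noteq> 0" "l \<noteq> 0" "k \<noteq> l" by (auto simp: l_def)
  qed
  have total: "lin_comb 2 (card V) A (\<lambda>_. 1) = all_ones_mat (card V)"
    and A0: "A 0 = 1\<^sub>m (card V)"
    using scheme by (auto simp: assoc_scheme_def)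
  have "cayley f = lin_comb 2 (card V) A (\<lambda>i. of_bool (i = k))"
    unfolding lin_comb_def k(2)[symmetric]
    using scheme k(1) by (intro eq_matI) (auto simp: assoc_scheme_def kl)
  then have "cayley f \<in> scheme_span 2 (card V) A" by (simp add: scheme_span_def)
  then have "cayley f * cayley f \<in> scheme_span 2 (card V) A"
    using scheme by (auto simp: assoc_scheme_def)
  then obtain c where c: "cayley (conv f f) = lin_comb 2 (card V) A c"
    by (auto simp: scheme_span_def cayley_mult)
  have "conv f f z = c l" if z: "z \<in> V" "z \<noteq> 0" "f z = 0" for z
  proof -
    obtain r s where rs: "r < card V" "enum r = 0" "s < card V" "enum s = z"
      using enum_surj[OF zero_mem] enum_surj[OF z(1)] by auto
    have "r \<noteq> s" using rs z by auto
    then have zeros: "A 0 $$ (r, s) = 0" "A k $$ (r, s) = 0"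
      using rs z by (auto simp: A0 k)
    have "lin_comb 2 (card V) A (\<lambda>_. 1) $$ (r, s) = all_ones_mat (card V) $$ (r, s)"
      using total by simp
    then have "A l $$ (r, s) = 1"
      using rs zeros kl by (simp add: lin_comb_def all_ones_mat_def)
    moreover have "conv f f z = lin_comb 2 (card V) A c $$ (r, s)"
      using rs by (simp add: c[symmetric])
    ultimately show ?thesis
      using rs zeros kl by (simp add: lin_comb_def)
  qed
  then show ?thesis using x y by simp
qed

text \<open>Let \<open>M\<close> be the adjacency matrix and \<open>E = M + t I\<close>. The hypothesis says \<open>E\<^sup>2 = n E + c J\<close>, so on vectors
with coordinate sum 0 the eigenvalues of \<open>E\<close> are among \<open>n\<close> and \<open>0\<close>, and those of \<open>M\<close> among \<open>n - t\<close>
and \<open>-t\<close>. Both occur: for \<open>\<rho> \<in> {0, n}\<close> the matrix \<open>E - (n - \<rho>) I\<close> maps vectors with sum 0 to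
eigenvectors for \<open>\<rho>\<close>, and it does not annihilate all differences of unit vectors, since otherwise
\<open>M\<close> would have constant entries off the diagonal.\<close>

lemma latin_square_type_cayley:
  fixes D :: "'g set" and n t :: nat and c :: real and e :: "'g \<Rightarrow> real"
  defines "e \<equiv> \<lambda>x. of_bool (x \<in> D) + real t * of_bool (x = 0)"
  assumes D: "D \<subseteq> V" "0 \<notin> D" "D \<noteq> {}" "insert 0 D \<noteq> V"
    and cards: "card V = n\<^sup>2" "n > 0" "t > 0" "card D = t * (n - 1)"
    and square: "\<And>z. z \<in> V \<Longrightarrow> conv e e z = n * e z + c"
  shows "latin_square_type (card V) (cayley (\<lambda>x. of_bool (x \<in> D)))"
proof -
  define cls :: "'g \<Rightarrow> nat" where "cls x = (if x = 0 then 0 else if x \<in> D then 1 else 2)" for x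
  define A where "A i = cayley (\<lambda>x. of_bool (cls x = i))" for i
  define M where "M = cayley (\<lambda>x. of_bool (x \<in> D))"
  obtain a1 where a1: "a1 \<in> D" "a1 \<in> V" "a1 \<noteq> 0" using D by auto
  obtain a2 where a2: "a2 \<notin> D" "a2 \<in> V" "a2 \<noteq> 0" using D zero_mem by auto
  have e_cls: "class_function cls e"
    unfolding e_def by (rule class_functionI[where c = "\<lambda>k. if k = 0 then real t else if k = 1 then 1 else 0"])
      (use D in \<open>auto simp: cls_def\<close>)
  have delta_cls: "class_function cls (\<lambda>x. of_bool (x = 0))"
    by (rule class_functionI[where c = "\<lambda>k. if k = 0 then 1 else 0"]) (auto simp: cls_def)
  define b :: "nat \<Rightarrow> 'g \<Rightarrow> real" where "b i = (if i = 0 then (\<lambda>x. of_bool (x = 0)) else if i = 1 then (\<lambda>_. 1) else e)" for i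
  have b_simps: "b 0 = (\<lambda>x. of_bool (x = 0))" "b 1 = (\<lambda>_. 1)" "b 2 = e"
    by (simp_all add: b_def)
  have b_cls: "class_function cls (b i)" for i
    by (simp add: b_def e_cls delta_cls class_function_const)
  have "cls ` V = {..2}"
    using a1 a2 zero_mem by (force simp: cls_def image_def atMost_def)
  then have scheme: "assoc_scheme 2 (card V) A"
    unfolding A_def
  proof (rule cayley_scheme)
    fix f g assume fg: "class_function cls f" "class_function cls g"
    show "class_function cls (conv f g)"
    proof (rule conv_closed_if_spanning[OF _ _ fg, where I = "{0, 1, 2}" and b = b])
      fix f assume "class_function cls f"
      then obtain k where k: "\<And>x. x \<in> V \<Longrightarrow> f x = k (cls x)"
        by (auto simp: class_function_def)
      show "\<exists>h. \<forall>x\<in>V. f x = (\<Sum>i\<in>{0, 1, 2}. h i * b i x)"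
        by (rule exI[of _ "\<lambda>i. if i = 0 then k 0 - k 2 - t * (k 1 - k 2) else if i = 1 then k 2 else k 1 - k 2"])
          (use D in \<open>auto simp: k b_def cls_def e_def algebra_simps\<close>)
    next
      fix i j :: nat assume "i \<in> {0, 1, 2}" "j \<in> {0, 1, 2}" "i \<le> j"
      then consider "i = 0" | "i = 1" | "i = 2" "j = 2" by fastforce
      then show "class_function cls (conv (b i) (b j))"
      proof cases
        case 1
        show ?thesis
          by (rule class_function_cong[OF b_cls[of j]]) (simp only: 1 b_simps conv_delta_left)
      next
        case 2
        show ?thesis
          by (rule class_function_cong[OF class_function_const]) (simp only: 2 b_simps conv_const_left)
      next
        case 3
        have "class_function cls (\<lambda>z. n * e z + c)"
          by (intro class_function_intros e_cls)
        then show ?thesis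
          by (rule class_function_cong) (simp only: 3 b_simps square)
      qed
    qed
  qed (simp add: cls_def)
  have A1: "A 1 = M"
    unfolding A_def M_def by (rule cayley_cong) (use D in \<open>auto simp: cls_def\<close>)
  then have srg: "strongly_regular_in (card V) A M"
    using scheme by (auto simp: strongly_regular_in_def)
  have valency: "has_valency (card V) M (t * (n - 1))"
    unfolding has_valency_def
  proof (intro allI impI)
    fix r assume r: "r < card V"
    have "bij_betw (\<lambda>s. enum r + enum s) {..<card V} V"
      using bij_betw_trans[OF bij_enum bij_translate[OF enum_mem[OF r]]] by (simp add: comp_def)
    then have bij: "bij_betw (\<lambda>s. enum r + enum s)
        {s \<in> {..<card V}. enum r + enum s \<in> D} {x \<in> V. x \<in> D}"
      by (rule bij_betw_Collect) simp
    have "{s \<in> {..<card V}. enum r + enum s \<in> D} = {s. s < card V \<and> M $$ (r, s) = 1}"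
      using r by (auto simp: M_def)
    moreover have "{x \<in> V. x \<in> D} = D" using D by auto
    ultimately show "card {s. s < card V \<and> M $$ (r, s) = 1} = t * (n - 1)"
      using bij_betw_same_card[OF bij] by (simp only: cards(4))
  qed
  have A_vec: "A 0 *\<^sub>v x = x" "A 1 *\<^sub>v x = M *\<^sub>v x"
    "A 0 *\<^sub>v x + A 1 *\<^sub>v x + A 2 *\<^sub>v x = vec (card V) (\<lambda>_. \<Sum>s<card V. x $ s)"
    if x: "x \<in> carrier_vec (card V)" for x
  proof -
    show "A 0 *\<^sub>v x = x" "A 1 *\<^sub>v x = M *\<^sub>v x"
      using scheme x unfolding A1 by (auto simp: assoc_scheme_def)
    have one: "of_bool (cls z = 0) * w + of_bool (cls z = 1) * w + of_bool (cls z = 2) * w = w"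
      for z and w :: real by (auto simp: cls_def)
    show "A 0 *\<^sub>v x + A 1 *\<^sub>v x + A 2 *\<^sub>v x = vec (card V) (\<lambda>_. \<Sum>s<card V. x $ s)"
      unfolding A_def
    proof (rule eq_vecI)
      fix r assume "r < dim_vec (vec (card V) (\<lambda>_. \<Sum>s<card V. x $ s))"
      then have r: "r < card V" by simp
      show "(cayley (\<lambda>x. of_bool (cls x = 0)) *\<^sub>v x + cayley (\<lambda>x. of_bool (cls x = 1)) *\<^sub>v x +
          cayley (\<lambda>x. of_bool (cls x = 2)) *\<^sub>v x) $ r = vec (card V) (\<lambda>_. \<Sum>s<card V. x $ s) $ r"
        using r x by (simp add: cayley_mult_vec_index sum.distrib[symmetric] one[unfolded One_nat_def]
              del: index_mult_mat_vec sum_of_bool_mult_eq sum_mult_of_bool_eq)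
    qed simp
  qed
  have e_vec: "cayley e *\<^sub>v x = M *\<^sub>v x + real t \<cdot>\<^sub>v x" if x: "x \<in> carrier_vec (card V)" for x
  proof (rule eq_vecI)
    fix r assume "r < dim_vec (M *\<^sub>v x + real t \<cdot>\<^sub>v x)"
    then have r: "r < card V" using x by simp
    have "(\<Sum>s<card V. e (enum r + enum s) * x $ s) =
        (\<Sum>s<card V. of_bool (enum r + enum s \<in> D) * x $ s) + (\<Sum>s<card V. if s = r then t * x $ s else 0)"
      unfolding sum.distrib[symmetric] e_def
      by (rule sum.cong) (auto simp: enum_add_eq_0_iff r algebra_simps)
    then show "(cayley e *\<^sub>v x) $ r = (M *\<^sub>v x + real t \<cdot>\<^sub>v x) $ r"
      using r x by (simp add: M_def cayley_mult_vec_index del: index_mult_mat_vec)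
  qed (use x in \<open>simp_all add: M_def\<close>)
  have "restricted_eigenvalues (card V) A M = {real n - real t, - real t}"
  proof (intro equalityI subsetI)
    fix \<theta> assume "\<theta> \<in> restricted_eigenvalues (card V) A M"
    then obtain E where E: "E \<in> common_eigenspaces 2 (card V) A"
      and nontriv: "E \<noteq> range (\<lambda>c. c \<cdot>\<^sub>v all_ones_vec (card V))"
      and M_E: "\<And>x. x \<in> E \<Longrightarrow> M *\<^sub>v x = \<theta> \<cdot>\<^sub>v x"
      by (auto simp: restricted_eigenvalues_def nontrivial_common_eigenspaces_def)
    then obtain \<eta> where E_def: "E = {x \<in> carrier_vec (card V). \<forall>i\<le>2. A i *\<^sub>v x = \<eta> i \<cdot>\<^sub>v x}"
      and "E \<noteq> {0\<^sub>v (card V)}"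
      by (auto simp: common_eigenspaces_def)
    moreover have A_car: "A i \<in> carrier_mat (card V) (card V)" for i by (simp add: A_def)
    have "A i *\<^sub>v 0\<^sub>v (card V) = \<eta> i \<cdot>\<^sub>v 0\<^sub>v (card V)" for i
      by (rule eq_vecI) (auto simp: A_def scalar_prod_def)
    then have "0\<^sub>v (card V) \<in> E" by (simp add: E_def)
    ultimately obtain x where x: "x \<in> E" "x \<noteq> 0\<^sub>v (card V)" by blast
    have E_car: "E \<subseteq> carrier_vec (card V)" by (auto simp: E_def)
    define mu where "mu = \<eta> 0 + \<eta> 1 + \<eta> 2"
    have J_E: "mu * y $ r = (\<Sum>s<card V. y $ s)" if y: "y \<in> E" and r: "r < card V" for y r
    proof -
      have yc: "y \<in> carrier_vec (card V)" using y E_car by auto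
      have "\<eta> 0 \<cdot>\<^sub>v y + \<eta> 1 \<cdot>\<^sub>v y + \<eta> 2 \<cdot>\<^sub>v y = vec (card V) (\<lambda>_. \<Sum>s<card V. y $ s)"
        using A_vec(3)[OF yc] y by (simp add: E_def)
      then have "(\<eta> 0 \<cdot>\<^sub>v y + \<eta> 1 \<cdot>\<^sub>v y + \<eta> 2 \<cdot>\<^sub>v y) $ r = (\<Sum>s<card V. y $ s)"
        using r by simp
      then show ?thesis using yc r by (simp add: mu_def algebra_simps)
    qed
    \<comment> \<open>\<open>J\<close> acts on \<open>E\<close> as the scalar \<open>mu\<close>. A vector in \<open>E\<close> with nonzero sum would force all of \<open>E\<close>
      to consist of multiples of the all-ones vector.\<close>
    have sum0: "(\<Sum>s<card V. x $ s) = 0"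
    proof (rule ccontr)
      assume S: "(\<Sum>s<card V. x $ s) \<noteq> 0"
      then have mu: "mu \<noteq> 0" using J_E[OF x(1) card_V_pos] by auto
      have const: "y = ((\<Sum>s<card V. y $ s) / mu) \<cdot>\<^sub>v all_ones_vec (card V)" if "y \<in> E" for y
        using J_E[OF that] mu E_car that
        by (intro eq_vecI) (auto simp: all_ones_vec_def field_simps)
      have scaled: "k \<cdot>\<^sub>v x \<in> E" for k
      proof -
        have "A i *\<^sub>v (k \<cdot>\<^sub>v x) = \<eta> i \<cdot>\<^sub>v (k \<cdot>\<^sub>v x)" if "i \<le> 2" for i
          using x(1) that A_car[of i]
          by (simp add: E_def mult_mat_vec smult_smult_assoc mult.commute)
        then show ?thesis using x(1) by (simp add: E_def)
      qed
      have "k \<cdot>\<^sub>v all_ones_vec (card V) \<in> E" for k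
      proof -
        have "k \<cdot>\<^sub>v all_ones_vec (card V) = (k * mu / (\<Sum>s<card V. x $ s)) \<cdot>\<^sub>v x"
          using S mu by (subst (2) const[OF x(1)]) (simp add: smult_smult_assoc)
        then show ?thesis using scaled by simp
      qed
      then have "E = range (\<lambda>c. c \<cdot>\<^sub>v all_ones_vec (card V))"
        using const by blast
      then show False using nontriv by simp
    qed
    have xc: "x \<in> carrier_vec (card V)" using x E_car by auto
    have ev: "cayley e *\<^sub>v x = (\<theta> + t) \<cdot>\<^sub>v x"
      using e_vec[OF xc] M_E[OF x(1)] by (simp add: add_smult_distrib_vec)
    obtain r where r: "r < card V" "x $ r \<noteq> 0"
      using x(2) xc by (metis carrier_vecD eq_vecI index_zero_vec(1) index_zero_vec(2))
    have "(\<theta> + t) * (\<theta> + t) * x $ r = (cayley e *\<^sub>v (cayley e *\<^sub>v x)) $ r"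
      using xc r by (simp add: ev mult_mat_vec[OF cayley_carrier xc] del: index_mult_mat_vec)
    also have "cayley e *\<^sub>v (cayley e *\<^sub>v x) = (cayley e * cayley e) *\<^sub>v x"
      by (rule assoc_mult_mat_vec[symmetric]) (use xc in auto)
    also have "cayley e * cayley e = cayley (\<lambda>z. n * e z + c)"
      unfolding cayley_mult by (rule cayley_cong) (rule square)
    also have "(cayley (\<lambda>z. n * e z + c) *\<^sub>v x) $ r = n * (cayley e *\<^sub>v x) $ r + c * (\<Sum>s<card V. x $ s)"
      using xc r by (simp add: cayley_mult_vec_index sum.distrib sum_distrib_left algebra_simps del: index_mult_mat_vec)
    also have "\<dots> = n * (\<theta> + t) * x $ r"
      using xc r by (simp add: ev sum0 del: index_mult_mat_vec)
    finally have "(\<theta> + t) * (\<theta> + t - n) * x $ r = 0"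
      by (simp add: algebra_simps)
    then have "(\<theta> + t) * (\<theta> + t - n) = 0" using r(2) by simp
    then show "\<theta> \<in> {real n - real t, - real t}" by auto
  next
    fix \<theta> assume \<theta>: "\<theta> \<in> {real n - real t, - real t}"
    define \<rho> where "\<rho> = \<theta> + t"
    have \<rho>: "\<rho> = n \<or> \<rho> = 0" using \<theta> by (auto simp: \<rho>_def)
    have "e a2 - t + (n - \<rho>) \<noteq> 0 \<or> \<rho> = 0 \<and> e a1 - t + (n - \<rho>) \<noteq> 0"
      using \<rho> a1 a2 cards by (auto simp: e_def)
    then obtain a where a: "a \<in> V" "a \<noteq> 0" "e a - t + (n - \<rho>) \<noteq> 0"
      using a1 a2 by auto
    \<comment> \<open>\<open>h\<close> is the image of the difference of the unit vectors at \<open>a\<close> and \<open>0\<close> under \<open>E - (n - \<rho>) I\<close>.\<close>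
    define h where "h z = e (z + a) - e z - (n - \<rho>) * (of_bool (z + a = 0) - of_bool (z = 0))" for z
    define x where "x = vec (card V) (\<lambda>r. h (enum r))"
    have xc: "x \<in> carrier_vec (card V)" by (simp add: x_def)
    have transl: "(\<Sum>y\<in>V. f (y + a)) = (\<Sum>y\<in>V. f y)" for f :: "'g \<Rightarrow> real"
      using sum_translate[OF a(1), of f] by (simp add: add.commute)
    have "(\<Sum>s<card V. x $ s) = (\<Sum>y\<in>V. h y)"
      by (simp add: x_def sum_enum[symmetric])
    also have "\<dots> = 0"
      using transl[of e] transl[of "\<lambda>y. of_bool (y = 0)"]
      by (simp add: h_def sum_subtractf sum_distrib_left[symmetric])
    finally have sum0: "(\<Sum>s<card V. x $ s) = 0" .
    obtain r0 where r0: "r0 < card V" "enum r0 = 0" using enum_surj[OF zero_mem] by auto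
    have "x $ r0 \<noteq> 0"
      using r0 a D by (simp add: x_def h_def e_def)
    then have x0: "x \<noteq> 0\<^sub>v (card V)" using r0 by auto
    have conv_h: "conv e h z = \<rho> * h z" if z: "z \<in> V" for z
    proof -
      have shift: "conv e (\<lambda>y. f (y + a)) z = conv e f (z + a)" for f
        by (simp add: conv_def add.assoc)
      have "conv e h z = (conv e e (z + a) - conv e e z) - (n - \<rho>) * (e (z + a) - e z)"
        unfolding h_def conv_linear shift[of e] shift[of "\<lambda>y. of_bool (y = 0)"]
        using z a by (simp add: conv_delta_right add_mem)
      also have "\<dots> = \<rho> * (e (z + a) - e z)"
        using z a by (simp add: square add_mem algebra_simps)
      also have "\<dots> = \<rho> * h z"
        using \<rho> by (auto simp: h_def algebra_simps)
      finally show ?thesis .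
    qed
    have "cayley e *\<^sub>v x = \<rho> \<cdot>\<^sub>v x"
    proof (rule eq_vecI)
      fix r assume "r < dim_vec (\<rho> \<cdot>\<^sub>v x)"
      then have r: "r < card V" by (simp add: x_def)
      have "(cayley e *\<^sub>v x) $ r = (\<Sum>s<card V. e (enum r + enum s) * h (enum s))"
        using r xc by (simp add: cayley_mult_vec_index x_def del: index_mult_mat_vec)
      also have "\<dots> = (\<Sum>y\<in>V. e (enum r + y) * h y)" by (rule sum_enum)
      also have "\<dots> = conv h e (enum r)"
        by (simp add: conv_def add.commute mult.commute)
      also have "\<dots> = \<rho> * h (enum r)"
        using conv_commute conv_h enum_mem[OF r] by metis
      finally show "(cayley e *\<^sub>v x) $ r = (\<rho> \<cdot>\<^sub>v x) $ r"
        using r by (simp add: x_def)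
    qed (simp add: x_def)
    then have eM: "M *\<^sub>v x + real t \<cdot>\<^sub>v x = \<rho> \<cdot>\<^sub>v x" using e_vec[OF xc] by simp
    have Mx: "M *\<^sub>v x = \<theta> \<cdot>\<^sub>v x"
    proof (rule eq_vecI)
      fix r assume "r < dim_vec (\<theta> \<cdot>\<^sub>v x)"
      then have r: "r < card V" by (simp add: x_def)
      have "(M *\<^sub>v x + real t \<cdot>\<^sub>v x) $ r = (\<rho> \<cdot>\<^sub>v x) $ r" using eM by simp
      then show "(M *\<^sub>v x) $ r = (\<theta> \<cdot>\<^sub>v x) $ r"
        using r xc by (simp add: \<rho>_def algebra_simps M_def del: index_mult_mat_vec)
    qed (simp add: x_def M_def)
    have A2x: "A 2 *\<^sub>v x = (- 1 - \<theta>) \<cdot>\<^sub>v x"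
    proof (rule eq_vecI)
      fix r assume "r < dim_vec ((- 1 - \<theta>) \<cdot>\<^sub>v x)"
      then have r: "r < card V" by (simp add: x_def)
      have "(A 0 *\<^sub>v x + A 1 *\<^sub>v x + A 2 *\<^sub>v x) $ r = 0"
        using A_vec(3)[OF xc] r sum0 by simp
      then have "x $ r + \<theta> * x $ r + (A 2 *\<^sub>v x) $ r = 0"
        using r xc unfolding A_vec(1,2)[OF xc] Mx by (simp add: A_def del: index_mult_mat_vec)
      then show "(A 2 *\<^sub>v x) $ r = ((- 1 - \<theta>) \<cdot>\<^sub>v x) $ r"
        using r xc by (simp add: algebra_simps del: index_mult_mat_vec)
    qed (simp add: x_def A_def)
    define \<eta> :: "nat \<Rightarrow> real" where "\<eta> i = (if i = 0 then 1 else if i = 1 then \<theta> else - 1 - \<theta>)" for i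
    define E where "E = {x \<in> carrier_vec (card V). \<forall>i\<le>2. A i *\<^sub>v x = \<eta> i \<cdot>\<^sub>v x}"
    have "A i *\<^sub>v x = \<eta> i \<cdot>\<^sub>v x" if "i \<le> 2" for i
    proof -
      have "i = 0 \<or> i = 1 \<or> i = 2" using that by linarith
      then show ?thesis using A_vec(1,2)[OF xc] Mx A2x by (elim disjE) (simp_all add: \<eta>_def)
    qed
    then have "x \<in> E" using xc by (simp add: E_def)
    then have "E \<in> common_eigenspaces 2 (card V) A"
      using x0 by (auto simp: common_eigenspaces_def E_def)
    moreover have "E \<noteq> range (\<lambda>c. c \<cdot>\<^sub>v all_ones_vec (card V))"
    proof
      assume "E = range (\<lambda>c. c \<cdot>\<^sub>v all_ones_vec (card V))"
      then obtain k where k: "x = k \<cdot>\<^sub>v all_ones_vec (card V)" using \<open>x \<in> E\<close> by auto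
      have "(\<Sum>s<card V. x $ s) = card V * k" by (simp add: k all_ones_vec_def)
      then have "k = 0" using sum0 card_V_pos by simp
      then show False using x0 by (auto simp: k all_ones_vec_def)
    qed
    moreover have "M *\<^sub>v y = \<theta> \<cdot>\<^sub>v y" if "y \<in> E" for y
    proof -
      have "A 1 *\<^sub>v y = \<eta> 1 \<cdot>\<^sub>v y" using that unfolding E_def by auto
      then show ?thesis using A1 by (simp add: \<eta>_def)
    qed
    ultimately show "\<theta> \<in> restricted_eigenvalues (card V) A M"
      unfolding restricted_eigenvalues_def nontrivial_common_eigenspaces_def by blast
  qed
  then show ?thesis
    unfolding latin_square_type_def using srg valency cards by (auto simp: M_def)
qed

end

section \<open>Convolutions on a hyperbolic quadric in characteristic 2\<close>

text \<open>The set \<open>F\<close> is a finite subfield of \<open>'a\<close>. The root \<open>\<alpha>\<close> generates a subfield with eight elements inside it.\<close>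

locale quadric_setup =
  fixes F :: "'a::field set" and \<alpha> :: 'a and \<psi> :: "'a \<Rightarrow> real"
  assumes finite_F: "finite F"
    and F_one: "1 \<in> F"
    and F_add: "x \<in> F \<Longrightarrow> y \<in> F \<Longrightarrow> x + y \<in> F"
    and F_mult: "x \<in> F \<Longrightarrow> y \<in> F \<Longrightarrow> x * y \<in> F"
    and F_inverse: "x \<in> F \<Longrightarrow> inverse x \<in> F"
    and char_2: "(1 :: 'a) + 1 = 0"
    and alpha_mem: "\<alpha> \<in> F"
    and alpha: "\<alpha> ^ 3 = \<alpha> + 1"
    and psi_add: "x \<in> F \<Longrightarrow> y \<in> F \<Longrightarrow> \<psi> (x + y) = \<psi> x * \<psi> y"
    and psi_range: "x \<in> F \<Longrightarrow> \<psi> x = 1 \<or> \<psi> x = - 1"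
    and psi_nontrivial: "\<exists>x\<in>F. \<psi> x \<noteq> 1"
begin

lemma add_self: "x + x = (0 :: 'a)"
  using char_2 by (metis distrib_left mult.right_neutral mult_zero_right)

lemma add_self_left: "x + (x + y) = (y :: 'a)"
  by (simp add: add.assoc[symmetric] add_self)

lemma F_zero: "0 \<in> F"
  using F_add[OF F_one F_one] by (simp only: char_2)

lemma F_divide: "x \<in> F \<Longrightarrow> y \<in> F \<Longrightarrow> x / y \<in> F"
  by (simp add: divide_inverse F_mult F_inverse)

lemmas F_closed = F_zero F_one F_add F_mult F_divide alpha_mem

lemma eq_iff_add: "x + y = (0 :: 'a) \<longleftrightarrow> x = y"
  by (metis add_self add_left_cancel)

lemma psi_0: "\<psi> 0 = 1"
  using psi_add[OF F_zero F_zero] psi_range[OF F_zero] by auto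

definition q :: nat where "q = card F"

text \<open>The order of the Latin squares, as a real number because it occurs as a coefficient in convolutions.\<close>

definition N :: real where "N = real q ^ 2"

lemma q_pos: "q > 0"
  using finite_F F_one by (auto simp: q_def card_gt_0_iff)

lemma N_pos: "N > 0"
  using q_pos by (simp add: N_def)

text \<open>Translating the sum by an element \<open>w\<close> with \<open>\<psi>(w c) = -1\<close> changes its sign.\<close>

lemma sum_psi:
  assumes c: "c \<in> F"
  shows "(\<Sum>x\<in>F. \<psi> (x * c)) = q * of_bool (c = 0)"
proof (cases "c = 0")
  case True
  then show ?thesis by (simp add: psi_0 q_def)
next
  case False
  obtain y where y: "y \<in> F" "\<psi> y \<noteq> 1" using psi_nontrivial by blast
  define w where "w = y / c"
  have w: "w \<in> F" "\<psi> (w * c) = - 1"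
    using y c False psi_range[OF y(1)] by (auto simp: w_def F_divide)
  have "bij_betw (\<lambda>x. x + w) F F"
    by (rule bij_betwI[where g = "\<lambda>x. x + w"]) (auto simp: F_add w add.assoc add_self)
  then have "(\<Sum>x\<in>F. \<psi> (x * c)) = (\<Sum>x\<in>F. \<psi> ((x + w) * c))"
    by (rule sum.reindex_bij_betw[symmetric])
  also have "\<dots> = (\<Sum>x\<in>F. \<psi> (x * c) * \<psi> (w * c))"
    by (rule sum.cong) (auto simp: distrib_right psi_add F_mult w c)
  also have "\<dots> = - (\<Sum>x\<in>F. \<psi> (x * c))"
    by (simp add: w sum_negf)
  finally show ?thesis using False by simp
qed

definition V :: "('a \<times> 'a \<times> 'a \<times> 'a) set" where "V = F \<times> F \<times> F \<times> F"

fun qf :: "'a \<times> 'a \<times> 'a \<times> 'a \<Rightarrow> 'a" where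
  "qf (x1, x2, x3, x4) = x1 * x4 + x2 * x3"

definition \<phi> :: "'a \<Rightarrow> 'a \<times> 'a \<times> 'a \<times> 'a \<Rightarrow> real" where
  "\<phi> l x = \<psi> (l * qf x)"

text \<open>The subspace \<open>{(a, b, k a, k b)}\<close> is totally singular because \<open>a k b + b k a = 0\<close> in characteristic 2.\<close>

fun on_line :: "'a \<Rightarrow> 'a \<times> 'a \<times> 'a \<times> 'a \<Rightarrow> bool" where
  "on_line k (x1, x2, x3, x4) \<longleftrightarrow> x3 = k * x1 \<and> x4 = k * x2"

definition line :: "'a \<Rightarrow> 'a \<times> 'a \<times> 'a \<times> 'a \<Rightarrow> real" where
  "line k x = of_bool (on_line k x)"

lemma qf_mem: "x \<in> V \<Longrightarrow> qf x \<in> F"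
  by (cases x) (auto simp: V_def F_closed)

sublocale boolean_group V
  by unfold_locales (auto simp: V_def finite_F F_closed add_self zero_prod_def)

lemma card_V: "real (card V) = N\<^sup>2"
  by (simp add: V_def N_def q_def card_cartesian_product power2_eq_square)

lemma sum_V: "(\<Sum>x\<in>V. f x) = (\<Sum>x1\<in>F. \<Sum>x2\<in>F. \<Sum>x3\<in>F. \<Sum>x4\<in>F. f (x1, x2, x3, x4))"
  by (simp add: V_def sum.cartesian_product split_def)

lemma sum_phi:
  assumes l: "l \<in> F" "l \<noteq> 0"
  shows "(\<Sum>x\<in>V. \<phi> l x) = N"
proof -
  have "(\<Sum>x\<in>V. \<phi> l x) =
      (\<Sum>x1\<in>F. \<Sum>x2\<in>F. \<Sum>x3\<in>F. \<Sum>x4\<in>F. \<psi> (x3 * (l * x2)) * \<psi> (x4 * (l * x1)))"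
    unfolding sum_V \<phi>_def
    by (intro sum.cong refl) (simp add: psi_add[symmetric] F_closed l algebra_simps)
  also have "\<dots> = (\<Sum>x1\<in>F. \<Sum>x2\<in>F. (\<Sum>x3\<in>F. \<psi> (x3 * (l * x2))) * (\<Sum>x4\<in>F. \<psi> (x4 * (l * x1))))"
    by (simp only: sum_product)
  also have "\<dots> = (\<Sum>x1\<in>F. \<Sum>x2\<in>F. N * (of_bool (x1 = 0) * of_bool (x2 = 0)))"
    by (intro sum.cong refl) (simp add: sum_psi F_closed l N_def power2_eq_square)
  also have "\<dots> = N"
    by (simp add: sum_distrib_left[symmetric] of_bool_def finite_F F_zero)
  finally show ?thesis .
qed

lemma smult_mem: "k \<in> F \<Longrightarrow> (x1, x2, x3, x4) \<in> V \<Longrightarrow> (k * x1, k * x2, k * x3, k * x4) \<in> V"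
  by (simp add: V_def F_mult)

text \<open>With \<open>s = l + m\<close> and \<open>k = m / s\<close>, completing the square gives
\<open>l Q(y) + m Q(y + z) = s Q(y + k z) + c Q(z)\<close>, and the sum over \<open>y\<close> becomes the Gauss sum \<open>sum_phi\<close>.
The hypothesis on \<open>c\<close> is \<open>1/c = 1/l + 1/m\<close> without the denominators.\<close>

lemma conv_phi_phi:
  assumes l: "l \<in> F" and m: "m \<in> F" and l0: "l \<noteq> 0" and c: "c * (l + m) = l * m"
    and z: "z \<in> V"
  shows "conv (\<phi> l) (\<phi> m) z = N * \<phi> c z"
proof -
  have neq: "l \<noteq> m" using l0 c by (auto simp: add_self)
  define s where "s = l + m"
  define k where "k = m / s"
  have s: "s \<in> F" "s \<noteq> 0" using l m neq by (auto simp: s_def F_add eq_iff_add)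
  have k: "k \<in> F" "s * k = m" using s m by (auto simp: k_def F_divide)
  have cF: "c \<in> F"
    using c s l m F_closed by (metis nonzero_mult_div_cancel_right s_def)
  have c_s: "s * (k * k) + c = m"
  proof -
    have "s * (s * (k * k) + c) = m * m + l * m"
      using k(2) c by (simp add: s_def[symmetric] algebra_simps)
    also have "\<dots> = s * m" by (simp add: s_def algebra_simps)
    finally show ?thesis using s by simp
  qed
  obtain z1 z2 z3 z4 where z_eq: "z = (z1, z2, z3, z4)" by (cases z)
  define w where "w = (k * z1, k * z2, k * z3, k * z4)"
  have w: "w \<in> V" using smult_mem k z by (simp add: w_def z_eq)
  have square: "l * qf y + m * qf (y + z) = s * qf (w + y) + c * qf z" for y
  proof -
    obtain y1 y2 y3 y4 where y: "y = (y1, y2, y3, y4)" by (cases y)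
    define B where "B = y1 * z4 + y4 * z1 + y2 * z3 + y3 * z2"
    have "l * qf y + m * qf (y + z) = s * qf y + m * B + m * qf z"
      by (simp add: y z_eq B_def s_def algebra_simps)
    also have "\<dots> = s * qf y + (s * k) * B + (s * (k * k) + c) * qf z"
      by (simp only: k(2) c_s)
    also have "\<dots> = s * qf (w + y) + c * qf z"
      by (simp add: y z_eq B_def w_def algebra_simps)
    finally show ?thesis .
  qed
  have "conv (\<phi> l) (\<phi> m) z = (\<Sum>y\<in>V. \<phi> s (w + y) * \<phi> c z)"
    unfolding conv_def
  proof (rule sum.cong[OF refl])
    fix y assume y: "y \<in> V"
    have "\<phi> l y * \<phi> m (y + z) = \<psi> (l * qf y + m * qf (y + z))"
      using y z l m by (simp add: \<phi>_def psi_add qf_mem F_mult add_mem)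
    also have "\<dots> = \<phi> s (w + y) * \<phi> c z"
      unfolding square using y z w s cF by (simp add: \<phi>_def psi_add qf_mem F_mult add_mem)
    finally show "\<phi> l y * \<phi> m (y + z) = \<phi> s (w + y) * \<phi> c z" .
  qed
  also have "\<dots> = (\<Sum>y\<in>V. \<phi> s y) * \<phi> c z"
    using sum_translate[OF w, of "\<phi> s"] by (simp add: sum_distrib_right[symmetric])
  finally show ?thesis by (simp add: sum_phi s)
qed

text \<open>For equal parameters the quadratic terms in \<open>y\<close> cancel. What is left is a nontrivial linear
character in \<open>y\<close> unless \<open>z = 0\<close>.\<close>

lemma conv_phi_self:
  assumes l: "l \<in> F" "l \<noteq> 0" and z: "z \<in> V"
  shows "conv (\<phi> l) (\<phi> l) z = N\<^sup>2 * of_bool (z = 0)"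
proof -
  obtain z1 z2 z3 z4 where z_eq: "z = (z1, z2, z3, z4)" by (cases z)
  have zF: "z1 \<in> F" "z2 \<in> F" "z3 \<in> F" "z4 \<in> F" using z by (auto simp: z_eq V_def)
  have split: "\<phi> l (y1, y2, y3, y4) * \<phi> l ((y1, y2, y3, y4) + z) =
      \<phi> l z * (\<psi> (y1 * (l * z4)) * (\<psi> (y2 * (l * z3)) * (\<psi> (y3 * (l * z2)) * \<psi> (y4 * (l * z1)))))"
    if "y1 \<in> F" "y2 \<in> F" "y3 \<in> F" "y4 \<in> F" for y1 y2 y3 y4
  proof -
    have "l * (y1 * y4 + y2 * y3) + l * ((y1 + z1) * (y4 + z4) + (y2 + z2) * (y3 + z3)) =
        l * (z1 * z4 + z2 * z3) + (y1 * (l * z4) + (y2 * (l * z3) + (y3 * (l * z2) + y4 * (l * z1))))"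
      by (simp add: algebra_simps add_self_left add_self)
    then show ?thesis
      using that zF l by (simp add: \<phi>_def z_eq psi_add[symmetric] F_closed)
  qed
  have "conv (\<phi> l) (\<phi> l) z = \<phi> l z * ((\<Sum>y1\<in>F. \<psi> (y1 * (l * z4))) * ((\<Sum>y2\<in>F. \<psi> (y2 * (l * z3))) *
      ((\<Sum>y3\<in>F. \<psi> (y3 * (l * z2))) * (\<Sum>y4\<in>F. \<psi> (y4 * (l * z1))))))"
    unfolding conv_def sum_V
    by (simp add: split cong: sum.cong) (simp only: sum_distrib_left[symmetric] sum_distrib_right[symmetric])
  also have "\<dots> = \<phi> l z * (q ^ 4 * of_bool (z = 0))"
    using l zF by (simp add: sum_psi F_mult z_eq zero_prod_def power4_eq_xxxx of_bool_def)
  also have "\<dots> = N\<^sup>2 * of_bool (z = 0)"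
    by (simp add: \<phi>_def z_eq zero_prod_def psi_0 N_def of_bool_def power_mult[symmetric])
  finally show ?thesis .
qed

lemma sum_line:
  assumes "k \<in> F"
  shows "(\<Sum>y\<in>V. line k y * g y) = (\<Sum>a\<in>F. \<Sum>b\<in>F. g (a, b, k * a, k * b))"
proof -
  have "(\<Sum>y\<in>V. line k y * g y) =
      (\<Sum>a\<in>F. \<Sum>b\<in>F. \<Sum>c\<in>F. \<Sum>d\<in>F. if d = k * b then (if c = k * a then g (a, b, c, k * b) else 0) else 0)"
    unfolding sum_V by (intro sum.cong refl) (auto simp: line_def)
  also have "\<dots> = (\<Sum>a\<in>F. \<Sum>b\<in>F. g (a, b, k * a, k * b))"
    by (intro sum.cong refl) (simp add: finite_F F_mult assms)
  finally show ?thesis .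
qed

lemma sum_line_1: "k \<in> F \<Longrightarrow> (\<Sum>y\<in>V. line k y) = N"
  using sum_line[of k "\<lambda>_. 1"] by (simp add: N_def q_def power2_eq_square)

lemma qf_line: "on_line k x \<Longrightarrow> qf x = 0"
  by (cases x) (auto simp: algebra_simps add_self)

text \<open>A line is its own orthogonal space with respect to the polar form of the quadratic form, so the
linear character that \<open>z\<close> induces on the line is trivial exactly when \<open>z\<close> lies on it.\<close>

lemma conv_line_phi:
  assumes k: "k \<in> F" and l: "l \<in> F" "l \<noteq> 0" and z: "z \<in> V"
  shows "conv (line k) (\<phi> l) z = N * line k z"
proof -
  obtain z1 z2 z3 z4 where z_eq: "z = (z1, z2, z3, z4)" by (cases z)
  have zF: "z1 \<in> F" "z2 \<in> F" "z3 \<in> F" "z4 \<in> F" using z by (auto simp: z_eq V_def)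
  have split: "\<phi> l ((a, b, k * a, k * b) + z) =
      \<phi> l z * (\<psi> (a * (l * (z4 + k * z2))) * \<psi> (b * (l * (z3 + k * z1))))"
    if "a \<in> F" "b \<in> F" for a b
  proof -
    have "l * ((a + z1) * (k * b + z4) + (b + z2) * (k * a + z3)) =
        l * (z1 * z4 + z2 * z3) + (a * (l * (z4 + k * z2)) + b * (l * (z3 + k * z1)))"
      by (simp add: algebra_simps add_self_left add_self)
    then show ?thesis
      using that zF l k by (simp add: \<phi>_def z_eq psi_add[symmetric] F_closed)
  qed
  have "conv (line k) (\<phi> l) z = \<phi> l z *
      ((\<Sum>a\<in>F. \<psi> (a * (l * (z4 + k * z2)))) * (\<Sum>b\<in>F. \<psi> (b * (l * (z3 + k * z1)))))"
    unfolding conv_def sum_line[OF k]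
    by (simp add: split cong: sum.cong) (simp only: sum_distrib_left[symmetric] sum_distrib_right[symmetric])
  also have "\<dots> = \<phi> l z * (N * line k z)"
    using l k zF
    by (simp add: sum_psi F_closed eq_iff_add N_def power2_eq_square line_def z_eq of_bool_def)
  also have "\<dots> = N * line k z"
    by (simp add: line_def \<phi>_def qf_line psi_0 of_bool_def)
  finally show ?thesis .
qed

lemma conv_line_self:
  assumes k: "k \<in> F" and z: "z \<in> V"
  shows "conv (line k) (line k) z = N * line k z"
proof -
  define L where "L = {x \<in> V. on_line k x}"
  have L: "x \<in> V \<Longrightarrow> line k x = of_bool (x \<in> L)" for x by (simp add: L_def line_def)
  have "real (card L) = (\<Sum>y\<in>V. of_bool (y \<in> L))"
    using finite_V by (simp add: L_def Int_def)
  also have "\<dots> = N" using sum_line_1[OF k] by (simp add: L cong: sum.cong)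
  finally have card: "real (card L) = N" .
  have "conv (line k) (line k) z = conv (\<lambda>x. of_bool (x \<in> L)) (\<lambda>x. of_bool (x \<in> L)) z"
    by (rule conv_cong) (auto simp: L z)
  also have "\<dots> = real (card L) * of_bool (z \<in> L)"
    by (rule conv_subgroup) (auto simp: L_def z add_mem algebra_simps elim!: on_line.elims)
  finally show ?thesis using card z by (simp add: L)
qed

text \<open>Two different lines are complementary, so every \<open>z\<close> is in exactly one way a sum of one element of each.\<close>

lemma conv_line_line:
  assumes k: "k \<in> F" and k': "k' \<in> F" and neq: "k \<noteq> k'" and z: "z \<in> V"
  shows "conv (line k) (line k') z = 1"
proof -
  obtain z1 z2 z3 z4 where z_eq: "z = (z1, z2, z3, z4)" by (cases z)
  have zF: "z1 \<in> F" "z2 \<in> F" "z3 \<in> F" "z4 \<in> F" using z by (auto simp: z_eq V_def)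
  have "k + k' \<noteq> 0" using neq by (simp add: eq_iff_add)
  have solve: "k * a + w = k' * (a + u) \<longleftrightarrow> a = (w + k' * u) / (k + k')" for a u w
  proof -
    have "k * a + w = k' * (a + u) \<longleftrightarrow> (k * a + w) + k' * (a + u) = 0"
      by (simp add: eq_iff_add)
    also have "\<dots> \<longleftrightarrow> a * (k + k') + (w + k' * u) = 0"
      by (simp add: algebra_simps)
    also have "\<dots> \<longleftrightarrow> a = (w + k' * u) / (k + k')"
      using \<open>k + k' \<noteq> 0\<close> by (simp add: eq_iff_add nonzero_eq_divide_eq)
    finally show ?thesis .
  qed
  have "conv (line k) (line k') z =
      (\<Sum>a\<in>F. \<Sum>b\<in>F. of_bool (a = (z3 + k' * z1) / (k + k')) * of_bool (b = (z4 + k' * z2) / (k + k')))"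
    unfolding conv_def sum_line[OF k] by (simp add: line_def z_eq solve of_bool_conj)
  also have "\<dots> = (\<Sum>a\<in>F. of_bool (a = (z3 + k' * z1) / (k + k'))) *
      (\<Sum>b\<in>F. of_bool (b = (z4 + k' * z2) / (k + k')))"
    by (simp only: sum_product)
  also have "\<dots> = 1"
    using k k' zF by (simp add: of_bool_def finite_F F_closed)
  finally show ?thesis .
qed

section \<open>The combination defined by the field with eight elements\<close>

text \<open>The elements of \<open>K = {0, 1, \<alpha>, \<dots>}\<close> of absolute trace 0 are \<open>0\<close>, \<open>\<alpha>\<close>, \<open>\<alpha>\<^sup>2\<close> and \<open>\<alpha>\<^sup>4 = \<alpha>\<^sup>2 + \<alpha>\<close>.
Thus \<open>H\<close> is the sum of \<open>\<phi>\<^sub>\<lambda>\<close> over \<open>\<lambda> \<in> K\<close>, \<open>\<lambda> \<noteq> 0, 1\<close>, with the sign \<open>(-1)\<^bsup>tr \<lambda>\<^esup>\<close>.\<close>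

definition H :: "'a \<times> 'a \<times> 'a \<times> 'a \<Rightarrow> real" where
  "H x = \<phi> \<alpha> x + \<phi> (\<alpha>\<^sup>2) x + \<phi> (\<alpha>\<^sup>2 + \<alpha>) x - \<phi> (\<alpha> + 1) x - \<phi> (\<alpha>\<^sup>2 + 1) x - \<phi> (\<alpha>\<^sup>2 + \<alpha> + 1) x"

lemma alpha_mult:
  "\<alpha> * \<alpha> = \<alpha>\<^sup>2" "\<alpha> * \<alpha>\<^sup>2 = \<alpha> + 1" "\<alpha>\<^sup>2 * \<alpha> = \<alpha> + 1" "\<alpha>\<^sup>2 * \<alpha>\<^sup>2 = \<alpha>\<^sup>2 + \<alpha>"
  "\<alpha> ^ 4 = \<alpha>\<^sup>2 + \<alpha>"
proof -
  show "\<alpha> * \<alpha> = \<alpha>\<^sup>2" by (simp add: power2_eq_square)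
  show ab: "\<alpha> * \<alpha>\<^sup>2 = \<alpha> + 1" "\<alpha>\<^sup>2 * \<alpha> = \<alpha> + 1"
    using alpha by (simp_all add: power2_eq_square power3_eq_cube mult.assoc)
  have "\<alpha>\<^sup>2 * \<alpha>\<^sup>2 = \<alpha> * (\<alpha> * \<alpha>\<^sup>2)" by (simp add: power2_eq_square mult.assoc)
  also have "\<dots> = \<alpha>\<^sup>2 + \<alpha>" by (simp only: ab) (simp add: distrib_left power2_eq_square)
  finally show "\<alpha>\<^sup>2 * \<alpha>\<^sup>2 = \<alpha>\<^sup>2 + \<alpha>" .
  then show "\<alpha> ^ 4 = \<alpha>\<^sup>2 + \<alpha>" by (simp add: power4_eq_xxxx power2_eq_square mult.assoc)
qed

lemma char_2_numerals: "(2 :: 'a) = 0" "(3 :: 'a) = 1" "(4 :: 'a) = 0"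
proof -
  show two: "(2 :: 'a) = 0" using char_2 by simp
  have "(3 :: 'a) = 2 + 1" "(4 :: 'a) = 2 + 2" by simp_all
  then show "(3 :: 'a) = 1" "(4 :: 'a) = 0" by (simp_all only: two add_0)
qed

text \<open>Rewriting with these rules turns every polynomial in \<open>\<alpha>\<close> of degree at most 4 into the
normal form \<open>a \<alpha>\<^sup>2 + b \<alpha> + c\<close>.\<close>

lemmas octic_simps = alpha_mult char_2_numerals add_self add_self_left algebra_simps

lemma octic_mem: "\<alpha>\<^sup>2 \<in> F" "\<alpha>\<^sup>2 + \<alpha> \<in> F" "\<alpha> + 1 \<in> F" "\<alpha>\<^sup>2 + 1 \<in> F" "\<alpha>\<^sup>2 + \<alpha> + 1 \<in> F"
  by (simp_all add: F_closed power2_eq_square)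

lemma octic_nonzero: "\<alpha> \<noteq> 0" "\<alpha>\<^sup>2 \<noteq> 0" "\<alpha>\<^sup>2 + \<alpha> \<noteq> 0" "\<alpha> + 1 \<noteq> 0" "\<alpha>\<^sup>2 + 1 \<noteq> 0" "\<alpha>\<^sup>2 + \<alpha> + 1 \<noteq> 0"
proof -
  have unit: "x \<noteq> 0" if "x * y = 1" for x y :: 'a using that by auto
  show "\<alpha> \<noteq> 0" by (rule unit[of _ "\<alpha>\<^sup>2 + 1"]) (simp add: octic_simps)
  show "\<alpha>\<^sup>2 \<noteq> 0" by (rule unit[of _ "\<alpha>\<^sup>2 + \<alpha> + 1"]) (simp add: octic_simps)
  show "\<alpha>\<^sup>2 + \<alpha> \<noteq> 0" by (rule unit[of _ "\<alpha> + 1"]) (simp add: octic_simps)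
  show "\<alpha> + 1 \<noteq> 0" by (rule unit[of _ "\<alpha>\<^sup>2 + \<alpha>"]) (simp add: octic_simps)
  show "\<alpha>\<^sup>2 + 1 \<noteq> 0" by (rule unit[of _ "\<alpha>"]) (simp add: octic_simps)
  show "\<alpha>\<^sup>2 + \<alpha> + 1 \<noteq> 0" by (rule unit[of _ "\<alpha>\<^sup>2"]) (simp add: octic_simps)
qed

text \<open>The table of \<open>l m / (l + m)\<close> for distinct nonzero elements \<open>l\<close>, \<open>m\<close> of the field with eight elements.\<close>

lemma conv_octic:
  assumes "z \<in> V"
  shows
    "conv (\<phi> (1)) (\<phi> (\<alpha>)) z = N * \<phi> (\<alpha>\<^sup>2 + \<alpha> + 1) z"
    "conv (\<phi> (1)) (\<phi> (\<alpha>\<^sup>2)) z = N * \<phi> (\<alpha> + 1) z"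
    "conv (\<phi> (1)) (\<phi> (\<alpha>\<^sup>2 + \<alpha>)) z = N * \<phi> (\<alpha>\<^sup>2 + 1) z"
    "conv (\<phi> (1)) (\<phi> (\<alpha> + 1)) z = N * \<phi> (\<alpha>\<^sup>2) z"
    "conv (\<phi> (1)) (\<phi> (\<alpha>\<^sup>2 + 1)) z = N * \<phi> (\<alpha>\<^sup>2 + \<alpha>) z"
    "conv (\<phi> (1)) (\<phi> (\<alpha>\<^sup>2 + \<alpha> + 1)) z = N * \<phi> (\<alpha>) z"
    "conv (\<phi> (\<alpha>)) (\<phi> (\<alpha>\<^sup>2)) z = N * \<phi> (\<alpha>\<^sup>2 + 1) z"
    "conv (\<phi> (\<alpha>)) (\<phi> (\<alpha>\<^sup>2 + \<alpha>)) z = N * \<phi> (\<alpha> + 1) z"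
    "conv (\<phi> (\<alpha>)) (\<phi> (\<alpha> + 1)) z = N * \<phi> (\<alpha>\<^sup>2 + \<alpha>) z"
    "conv (\<phi> (\<alpha>)) (\<phi> (\<alpha>\<^sup>2 + 1)) z = N * \<phi> (\<alpha>\<^sup>2) z"
    "conv (\<phi> (\<alpha>)) (\<phi> (\<alpha>\<^sup>2 + \<alpha> + 1)) z = N * \<phi> (1) z"
    "conv (\<phi> (\<alpha>\<^sup>2)) (\<phi> (\<alpha>\<^sup>2 + \<alpha>)) z = N * \<phi> (\<alpha>\<^sup>2 + \<alpha> + 1) z"
    "conv (\<phi> (\<alpha>\<^sup>2)) (\<phi> (\<alpha> + 1)) z = N * \<phi> (1) z"
    "conv (\<phi> (\<alpha>\<^sup>2)) (\<phi> (\<alpha>\<^sup>2 + 1)) z = N * \<phi> (\<alpha>) z"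
    "conv (\<phi> (\<alpha>\<^sup>2)) (\<phi> (\<alpha>\<^sup>2 + \<alpha> + 1)) z = N * \<phi> (\<alpha>\<^sup>2 + \<alpha>) z"
    "conv (\<phi> (\<alpha>\<^sup>2 + \<alpha>)) (\<phi> (\<alpha> + 1)) z = N * \<phi> (\<alpha>) z"
    "conv (\<phi> (\<alpha>\<^sup>2 + \<alpha>)) (\<phi> (\<alpha>\<^sup>2 + 1)) z = N * \<phi> (1) z"
    "conv (\<phi> (\<alpha>\<^sup>2 + \<alpha>)) (\<phi> (\<alpha>\<^sup>2 + \<alpha> + 1)) z = N * \<phi> (\<alpha>\<^sup>2) z"
    "conv (\<phi> (\<alpha> + 1)) (\<phi> (\<alpha>\<^sup>2 + 1)) z = N * \<phi> (\<alpha>\<^sup>2 + \<alpha> + 1) z"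
    "conv (\<phi> (\<alpha> + 1)) (\<phi> (\<alpha>\<^sup>2 + \<alpha> + 1)) z = N * \<phi> (\<alpha>\<^sup>2 + 1) z"
    "conv (\<phi> (\<alpha>\<^sup>2 + 1)) (\<phi> (\<alpha>\<^sup>2 + \<alpha> + 1)) z = N * \<phi> (\<alpha> + 1) z"
  by (rule conv_phi_phi[OF _ _ _ _ assms];
      (simp only: octic_mem alpha_mem F_one; fail | simp add: octic_nonzero; fail | simp add: octic_simps; fail))+

lemmas conv_octic_self = conv_phi_self[OF octic_mem(1) octic_nonzero(2)]
  conv_phi_self[OF octic_mem(2) octic_nonzero(3)] conv_phi_self[OF octic_mem(3) octic_nonzero(4)]
  conv_phi_self[OF octic_mem(4) octic_nonzero(5)] conv_phi_self[OF octic_mem(5) octic_nonzero(6)]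
  conv_phi_self[OF alpha_mem octic_nonzero(1)]

lemma H_eq: "H = (\<lambda>x. \<phi> \<alpha> x + \<phi> (\<alpha>\<^sup>2) x + \<phi> (\<alpha>\<^sup>2 + \<alpha>) x - \<phi> (\<alpha> + 1) x - \<phi> (\<alpha>\<^sup>2 + 1) x - \<phi> (\<alpha>\<^sup>2 + \<alpha> + 1) x)"
  by (rule ext) (rule H_def)

text \<open>Convolution with \<open>\<phi>\<^sub>1\<close> sends \<open>\<phi>\<^sub>\<lambda>\<close> to \<open>N \<phi>\<^sub>c\<close> with \<open>1/c = 1 + 1/\<lambda>\<close>. Each of the maps
\<open>\<lambda> \<mapsto> 1/\<lambda>\<close> and \<open>\<lambda> \<mapsto> \<lambda> + 1\<close> exchanges trace 0 and trace 1 on \<open>K - {0, 1}\<close>. Three of them occur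
here, so the signs in \<open>H\<close> are reversed.\<close>

lemma conv_phi_1_H:
  assumes "z \<in> V"
  shows "conv (\<phi> 1) H z = - N * H z"
  unfolding H_eq conv_linear conv_octic[OF assms] by (simp add: algebra_simps)

text \<open>The diagonal terms give \<open>\<delta>\<^sub>0\<close>. The others collect, by the table, to multiples of \<open>\<phi>\<^sub>1\<close> and \<open>H\<close>.\<close>

lemma conv_H_H:
  assumes z: "z \<in> V"
  shows "conv H H z = 6 * N\<^sup>2 * of_bool (z = 0) - 4 * N * H z - 6 * N * \<phi> 1 z"
  unfolding H_eq conv_linear conv_octic[OF z] conv_octic_self[OF z]
    conv_octic[OF z, THEN trans[OF conv_commute[OF z]]]
  by (simp add: algebra_simps)

text \<open>By \<open>conv_line_phi\<close> every \<open>\<phi>\<^sub>\<lambda>\<close> contributes the same function, and \<open>H\<close> has as many plus as minus signs.\<close>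

lemma conv_H_line:
  assumes k: "k \<in> F" and z: "z \<in> V"
  shows "conv H (line k) z = 0"
proof -
  have "conv (line k) H z = 0"
    unfolding H_eq conv_linear by (simp add: conv_line_phi k z octic_mem octic_nonzero alpha_mem)
  then show ?thesis using conv_commute[OF z] by metis
qed

lemma sum_H: "(\<Sum>x\<in>V. H x) = 0"
  by (simp add: H_def sum.distrib sum_subtractf sum_phi octic_mem octic_nonzero alpha_mem)

lemma phi_add: "l \<in> F \<Longrightarrow> m \<in> F \<Longrightarrow> x \<in> V \<Longrightarrow> \<phi> (l + m) x = \<phi> l x * \<phi> m x"
  by (simp add: \<phi>_def distrib_right psi_add qf_mem F_mult)

lemma phi_range: "l \<in> F \<Longrightarrow> x \<in> V \<Longrightarrow> \<phi> l x = 1 \<or> \<phi> l x = - 1"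
  by (simp add: \<phi>_def psi_range qf_mem F_mult)

text \<open>This is how \<open>H\<close> detects a class: \<open>H - \<phi>\<^sub>1 + 1\<close> is a product of three factors, each \<open>0\<close> or \<open>2\<close>, that
is nonzero only if \<open>\<phi> 1 x = -1\<close> and \<open>\<phi> \<alpha> x = \<phi> (\<alpha>\<^sup>2) x = 1\<close>.\<close>

lemma H_product:
  assumes "x \<in> V"
  shows "H x = (1 - \<phi> 1 x) * (1 + \<phi> \<alpha> x) * (1 + \<phi> (\<alpha>\<^sup>2) x) - 1 + \<phi> 1 x"
  unfolding H_def phi_add[OF octic_mem(2) F_one assms] phi_add[OF octic_mem(1) alpha_mem assms]
    phi_add[OF alpha_mem F_one assms] phi_add[OF octic_mem(1) F_one assms]
  by (simp add: algebra_simps)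

end

section \<open>The scheme\<close>

locale quadric_lines = quadric_setup +
  fixes m :: nat and \<kappa> :: "nat \<Rightarrow> 'a"
  assumes kappa_mem: "j < m \<Longrightarrow> \<kappa> j \<in> F"
    and kappa_inj: "inj_on \<kappa> {..<m}"
begin

lemma lines_disjoint: "on_line k x \<Longrightarrow> on_line k' x \<Longrightarrow> k \<noteq> k' \<Longrightarrow> x = 0"
  by (cases x) (auto simp: zero_prod_def)

lemma kappa_eq_iff: "i < m \<Longrightarrow> j < m \<Longrightarrow> \<kappa> i = \<kappa> j \<longleftrightarrow> i = j"
  using kappa_inj by (auto simp: inj_on_def)

text \<open>Class 0 is the zero vector, classes 1 and 2 are the two parts of \<open>\<phi>\<^sub>1 = -1\<close>, the classes from 4 on are
the chosen lines, and class 3 is what remains of \<open>\<phi>\<^sub>1 = 1\<close>.\<close>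

definition cls :: "'a \<times> 'a \<times> 'a \<times> 'a \<Rightarrow> nat" where
  "cls x = (if x = 0 then 0
    else if \<exists>j<m. on_line (\<kappa> j) x then 4 + (THE j. j < m \<and> on_line (\<kappa> j) x)
    else if \<phi> 1 x = 1 then 3
    else if \<phi> \<alpha> x = 1 \<and> \<phi> (\<alpha>\<^sup>2) x = 1 then 1 else 2)"

lemma cls_line: "x \<noteq> 0 \<Longrightarrow> j < m \<Longrightarrow> on_line (\<kappa> j) x \<Longrightarrow> cls x = 4 + j"
proof -
  assume x: "x \<noteq> 0" "j < m" "on_line (\<kappa> j) x"
  have "(THE i. i < m \<and> on_line (\<kappa> i) x) = j"
    using x lines_disjoint kappa_eq_iff by (intro the_equality) blast+
  then show "cls x = 4 + j" using x by (auto simp: cls_def)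
qed

lemma cls_eq_0_iff: "cls x = 0 \<longleftrightarrow> x = 0"
  by (simp add: cls_def)

lemma cls_0: "cls 0 = 0"
  by (simp add: cls_def)

lemma phi_line: "on_line k x \<Longrightarrow> \<phi> l x = 1"
  by (simp add: \<phi>_def qf_line psi_0)

lemma on_line_0: "on_line k 0"
  by (simp add: zero_prod_def)

lemma cls_cases:
  obtains "x = 0" "cls x = 0" | j where "x \<noteq> 0" "j < m" "on_line (\<kappa> j) x" "cls x = 4 + j"
  | "x \<noteq> 0" "\<And>j. j < m \<Longrightarrow> \<not> on_line (\<kappa> j) x"
    "cls x = (if \<phi> 1 x = 1 then 3 else if \<phi> \<alpha> x = 1 \<and> \<phi> (\<alpha>\<^sup>2) x = 1 then 1 else 2)"
proof -
  consider "x = 0" | "x \<noteq> 0" "\<exists>j<m. on_line (\<kappa> j) x" | "x \<noteq> 0" "\<not> (\<exists>j<m. on_line (\<kappa> j) x)" by blast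
  then show ?thesis
  proof cases
    case 1
    then show ?thesis using that(1) cls_eq_0_iff by simp
  next
    case 2
    then show ?thesis using that(2) cls_line by blast
  next
    case 3
    then show ?thesis by (intro that(3)) (auto simp: cls_def)
  qed
qed

lemma phi_1_cls: "x \<in> V \<Longrightarrow> \<phi> 1 x = (if cls x = 1 \<or> cls x = 2 then - 1 else 1)"
  using phi_range[OF F_one, of x]
  by (cases x rule: cls_cases) (auto simp: phi_line on_line_0 split: if_splits)

lemma H_cls: "x \<in> V \<Longrightarrow> H x = (if cls x = 1 then 6 else if cls x = 2 then - 2 else 0)"
  using phi_range[OF F_one, of x] phi_range[OF alpha_mem, of x] phi_range[OF octic_mem(1), of x]
  by (cases x rule: cls_cases) (auto simp: H_product phi_line on_line_0 split: if_splits)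

lemma line_cls: "j < m \<Longrightarrow> line (\<kappa> j) x = of_bool (cls x = 0 \<or> cls x = 4 + j)"
proof (cases x rule: cls_cases)
  case (2 i)
  assume j: "j < m"
  have "on_line (\<kappa> j) x \<longleftrightarrow> j = i"
    using 2 lines_disjoint[OF 2(3)] kappa_eq_iff[OF 2(2) j] by metis
  then show ?thesis using 2 by (auto simp: line_def)
qed (auto simp: line_def on_line_0)

lemma cls_range: "cls x \<le> m + 3"
  by (cases x rule: cls_cases) auto

definition basis :: "nat \<Rightarrow> 'a \<times> 'a \<times> 'a \<times> 'a \<Rightarrow> real" where
  "basis i = (if i = 0 then \<lambda>x. of_bool (x = 0) else if i = 1 then \<lambda>_. 1
    else if i = 2 then \<phi> 1 else if i = 3 then H else line (\<kappa> (i - 4)))"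

lemma basis_simps: "basis 0 = (\<lambda>x. of_bool (x = 0))" "basis 1 = (\<lambda>_. 1)" "basis 2 = \<phi> 1"
  "basis 3 = H" "basis (4 + j) = line (\<kappa> j)"
  by (simp_all add: basis_def)

lemma less_4_cases:
  fixes k :: nat
  obtains "k = 0" | "k = 1" | "k = 2" | "k = 3" | "4 \<le> k"
proof (cases "4 \<le> k")
  case False
  then have "k \<in> {0, 1, 2, 3}" by auto
  then show ?thesis using that(1-4) by auto
qed (rule that(5))

lemma index_cases:
  assumes "i < m + 4"
  shows "i = 0 \<or> i = 1 \<or> i = 2 \<or> i = 3 \<or> (\<exists>j<m. i = 4 + j)"
  by (cases "i < 4") (use assms in \<open>auto intro!: exI[of _ "i - 4"]\<close>)

lemma class_function_basis:
  assumes "i < m + 4"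
  shows "class_function cls (basis i)"
proof -
  consider "i = 0" | "i = 1" | "i = 2" | "i = 3" | j where "i = 4 + j" "j < m"
    using index_cases[OF assms] by blast
  then show ?thesis
  proof cases
    case 1
    show ?thesis unfolding 1 basis_simps
      by (rule class_functionI[where c = "\<lambda>k. of_bool (k = 0)"]) (simp add: cls_eq_0_iff)
  next
    case 2
    show ?thesis unfolding 2 basis_simps by (rule class_function_const)
  next
    case 3
    show ?thesis unfolding 3 basis_simps by (rule class_functionI) (rule phi_1_cls)
  next
    case 4
    show ?thesis unfolding 4 basis_simps by (rule class_functionI) (rule H_cls)
  next
    case 5
    show ?thesis unfolding 5 basis_simps by (rule class_functionI) (rule line_cls[OF 5(2)])
  qed
qed

lemma sum_lessThan_add_4:
  fixes k :: nat
  shows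
  "(\<Sum>i<k + 4. g i) = g 0 + g 1 + g 2 + g 3 + (\<Sum>j<k. g (4 + j) :: real)"
  by (induction k) (simp_all add: eval_nat_numeral algebra_simps)

lemma sum_lines:
  "(\<Sum>j<m. h j * line (\<kappa> j) x) =
    (if cls x = 0 then \<Sum>j<m. h j else if cls x \<ge> 4 then h (cls x - 4) else 0)"
proof (cases x rule: cls_cases)
  case (2 i)
  have "(\<Sum>j<m. h j * line (\<kappa> j) x) = (\<Sum>j<m. if j = i then h j else 0)"
    by (rule sum.cong) (use 2 in \<open>auto simp: line_cls\<close>)
  then show ?thesis using 2 by simp
qed (auto simp: line_cls)

text \<open>The functions \<open>1\<close>, \<open>\<phi>\<^sub>1\<close> and \<open>H\<close> separate the classes 1, 2 and 3, and \<open>\<delta>\<^sub>0\<close> and the lines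
separate the other classes from class 3.\<close>

lemma basis_spans:
  assumes "class_function cls f"
  shows "\<exists>h. \<forall>x\<in>V. f x = (\<Sum>i\<in>{..<m + 4}. h i * basis i x)"
proof -
  obtain k where k: "\<And>x. x \<in> V \<Longrightarrow> f x = k (cls x)"
    using assms by (auto simp: class_function_def)
  \<comment> \<open>The zero vector lies on all lines, so their total weight \<open>S\<close> is taken back at \<open>\<delta>\<^sub>0\<close>.\<close>
  define S where "S = (\<Sum>j<m. k (4 + j) - k 3)"
  define u where "u = (k 1 - k 2) / 8"
  define w where "w = (k 2 - k 3) / 2"
  have k12: "k 1 = k 2 + 8 * u" "k 2 = k 3 + 2 * w" by (simp_all add: u_def w_def)
  define h where "h i = (if i = 0 then k 0 - k 3 - S else if i = 1 then k 3 + w + u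
    else if i = 2 then - w - u else if i = 3 then u else k i - k 3)" for i :: nat
  have "f x = (\<Sum>i\<in>{..<m + 4}. h i * basis i x)" if x: "x \<in> V" for x
  proof -
    have lines: "(\<Sum>j<m. h (4 + j) * line (\<kappa> j) x) =
        (if cls x = 0 then S else if cls x \<ge> 4 then k (cls x) - k 3 else 0)"
      unfolding sum_lines by (auto simp: h_def S_def)
    have h: "h 0 = k 0 - k 3 - S" "h 1 = k 3 + w + u" "h 2 = - w - u" "h 3 = u"
      by (simp_all add: h_def)
    have expand: "(\<Sum>i\<in>{..<m + 4}. h i * basis i x) =
        h 0 * of_bool (cls x = 0) + h 1 * 1 + h 2 * (if cls x = 1 \<or> cls x = 2 then - 1 else 1)
        + h 3 * (if cls x = 1 then 6 else if cls x = 2 then - 2 else 0)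
        + (if cls x = 0 then S else if cls x \<ge> 4 then k (cls x) - k 3 else 0)"
      unfolding sum_lessThan_add_4 basis_simps lines
      by (simp only: phi_1_cls[OF x] H_cls[OF x] cls_eq_0_iff)
    have "k (cls x) = (\<Sum>i\<in>{..<m + 4}. h i * basis i x)"
    proof (cases "cls x" rule: less_4_cases)
      case 1
      show ?thesis unfolding expand h 1 using k12 by simp
    next
      case 2
      show ?thesis unfolding expand h 2 using k12 by simp
    next
      case 3
      show ?thesis unfolding expand h 3 using k12 by simp
    next
      case 4
      show ?thesis unfolding expand h 4 using k12 by simp
    next
      case 5
      then show ?thesis unfolding expand h by simp
    qed
    then show ?thesis by (simp only: k[OF x])
  qed
  then show ?thesis by blast
qed

lemma basis_table:
  assumes "i \<in> {..<m + 4}" "j \<in> {..<m + 4}" "i \<le> j"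
  shows "class_function cls (conv (basis i) (basis j))"
proof -
  note cf = class_function_basis
  have delta: "class_function cls (\<lambda>x. of_bool (x = 0))" and phi: "class_function cls (\<phi> 1)"
    and H: "class_function cls H" and line: "\<And>l. l < m \<Longrightarrow> class_function cls (line (\<kappa> l))"
    using cf[of 0] cf[of 2] cf[of 3] cf[of "4 + l" for l] unfolding basis_simps by auto
  note cong = class_function_cong[OF _ sym]
  consider "i = 0" | "i = 1" | "i = 2" "j = 2" | "i = 2" "j = 3" | "i = 3" "j = 3"
    | b where "i = 2" "j = 4 + b" "b < m" | b where "i = 3" "j = 4 + b" "b < m"
    | a b where "i = 4 + a" "j = 4 + b" "a < m" "b < m"
  proof -
    from assms have "i < m + 4" "j < m + 4" by simp_all
    from assms index_cases[OF this(1)] index_cases[OF this(2)]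
    have "i = 0 \<or> i = 1 \<or> i = 2 \<and> j = 2 \<or> i = 2 \<and> j = 3 \<or> i = 3 \<and> j = 3 \<or>
        (\<exists>b<m. i = 2 \<and> j = 4 + b) \<or> (\<exists>b<m. i = 3 \<and> j = 4 + b) \<or>
        (\<exists>a<m. \<exists>b<m. i = 4 + a \<and> j = 4 + b)"
      by auto
    then show ?thesis using that by blast
  qed
  then show ?thesis
  proof cases
    case 1
    show ?thesis unfolding 1 basis_simps
      by (rule cong[OF cf[of j]]) (use assms in \<open>simp_all add: conv_delta_left\<close>)
  next
    case 2
    show ?thesis unfolding 2 basis_simps by (rule cong[OF class_function_const]) (rule conv_const_left)
  next
    case 3
    show ?thesis unfolding 3 basis_simps
      by (rule cong[OF class_function_scale[OF delta]]) (rule conv_phi_self[OF F_one one_neq_zero])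
  next
    case 4
    show ?thesis unfolding 4 basis_simps
      by (rule cong[OF class_function_scale[OF H]]) (rule conv_phi_1_H)
  next
    case 5
    have "class_function cls (\<lambda>z. 6 * N\<^sup>2 * of_bool (z = 0) - 4 * N * H z - 6 * N * \<phi> 1 z)"
      by (intro class_function_intros delta H phi)
    then show ?thesis unfolding 5 basis_simps by (rule cong) (rule conv_H_H)
  next
    case (6 b)
    have "conv (\<phi> 1) (line (\<kappa> b)) z = N * line (\<kappa> b) z" if "z \<in> V" for z
      using conv_commute[OF that] conv_line_phi[OF kappa_mem[OF 6(3)] F_one one_neq_zero that] by metis
    then show ?thesis unfolding 6 basis_simps
      by (rule cong[OF class_function_scale[OF line[OF 6(3)]]])
  next
    case (7 b)
    show ?thesis unfolding 7 basis_simps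
      by (rule cong[OF class_function_const]) (rule conv_H_line[OF kappa_mem[OF 7(3)]])
  next
    case (8 a b)
    show ?thesis
    proof (cases "a = b")
      case True
      show ?thesis unfolding 8 True basis_simps
        by (rule cong[OF class_function_scale[OF line[OF 8(4)]]]) (rule conv_line_self[OF kappa_mem[OF 8(4)]])
    next
      case False
      then have "\<kappa> a \<noteq> \<kappa> b" using 8 kappa_eq_iff by simp
      then show ?thesis unfolding 8 basis_simps
        by (intro cong[OF class_function_const[where a = 1]] conv_line_line kappa_mem 8)
    qed
  qed
qed

lemma ind_1: "x \<in> V \<Longrightarrow> of_bool (cls x = 1) = (1 / 8) * (H x - \<phi> 1 x + 1)"
  by (simp add: H_cls phi_1_cls)

lemma ind_2: "x \<in> V \<Longrightarrow> of_bool (cls x = 2) = (1 / 8) * (3 - 3 * \<phi> 1 x - H x)"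
  by (simp add: H_cls phi_1_cls)

lemma ind_3:
  assumes "x \<in> V"
  shows "of_bool (cls x = 3) =
    1 / 2 + (1 / 2) * \<phi> 1 x + (real m - 1) * of_bool (x = 0) - (\<Sum>j<m. line (\<kappa> j) x)"
proof -
  have lines: "(\<Sum>j<m. line (\<kappa> j) x) = (if cls x = 0 then m else if cls x \<ge> 4 then 1 else 0)"
    using sum_lines[of "\<lambda>_. 1" x] by simp
  show ?thesis
    unfolding lines phi_1_cls[OF assms] cls_eq_0_iff[symmetric]
    by (cases "cls x" rule: less_4_cases) simp_all
qed

text \<open>As the values of \<open>\<psi>\<close> sum to 0, half of them are \<open>-1\<close>.\<close>

lemma q_even: "even q"
proof -
  have "real q = (\<Sum>x\<in>F. 1 - \<psi> (x * 1))"
    unfolding sum_subtractf sum_psi[OF F_one] by (simp add: q_def)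
  also have "\<dots> = (\<Sum>x\<in>F. if \<psi> x = - 1 then 2 else 0)"
  proof (rule sum.cong[OF refl])
    fix x assume "x \<in> F"
    then show "1 - \<psi> (x * 1) = (if \<psi> x = - 1 then 2 else 0)" using psi_range[of x] by auto
  qed
  also have "\<dots> = real (2 * card {x \<in> F. \<psi> x = - 1})"
    using finite_F by (simp add: sum.inter_filter[symmetric])
  finally have "q = 2 * card {x \<in> F. \<psi> x = - 1}" by linarith
  then show ?thesis by simp
qed

lemma N_ge_4: "N \<ge> 4"
proof -
  have "q \<ge> 2" using q_even q_pos by presburger
  from mult_le_mono[OF this this] have "2 * 2 \<le> q * q" .
  then have "real (2 * 2) \<le> real (q * q)" by (simp only: of_nat_le_iff)
  then show ?thesis by (simp add: N_def power2_eq_square)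
qed

lemma m_le_q: "m \<le> q"
proof -
  have "card (\<kappa> ` {..<m}) \<le> card F"
    using kappa_mem by (intro card_mono finite_F) auto
  then show ?thesis by (simp add: card_image[OF kappa_inj] q_def)
qed

text \<open>The set \<open>\<phi>\<^sub>1 = 1\<close> without 0 has \<open>(N/2 + 1) (N - 1)\<close> elements, and each chosen line takes \<open>N - 1\<close> of them.\<close>

definition t :: nat where "t = q\<^sup>2 div 2 + 1 - m"

lemma t_pos: "t > 0" and t_eq: "real t = N / 2 + 1 - m"
proof -
  obtain r where r: "q = 2 * r" using q_even by (auto elim: evenE)
  have half: "q\<^sup>2 div 2 = r * q" by (simp add: r power2_eq_square)
  have "r > 0" using q_pos r by simp
  then have "q \<le> r * q" by simp
  then have "m \<le> r * q" using m_le_q by linarith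
  then show "t > 0" by (simp add: t_def half)
  have "real t = real (r * q) + 1 - real m"
    using \<open>m \<le> r * q\<close> by (simp add: t_def half of_nat_diff)
  then show "real t = N / 2 + 1 - m" by (simp add: N_def r power2_eq_square)
qed

lemma card_class: "real (card {x \<in> V. cls x = i}) = (\<Sum>x\<in>V. of_bool (cls x = i))"
  using finite_V by (simp add: Int_def)

lemma card_class_1: "real (card {x \<in> V. cls x = 1}) = (N\<^sup>2 - N) / 8"
proof -
  have "real (card {x \<in> V. cls x = 1}) = (\<Sum>x\<in>V. (1 / 8) * (H x - \<phi> 1 x + 1))"
    unfolding card_class by (rule sum.cong) (simp_all only: ind_1)
  also have "\<dots> = (N\<^sup>2 - N) / 8"
    unfolding sum_distrib_left[symmetric] sum.distrib sum_subtractf sum_H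
    by (simp add: sum_phi F_one card_V)
  finally show ?thesis .
qed

lemma card_class_2: "real (card {x \<in> V. cls x = 2}) = 3 * (N\<^sup>2 - N) / 8"
proof -
  have "real (card {x \<in> V. cls x = 2}) = (\<Sum>x\<in>V. (1 / 8) * (3 - 3 * \<phi> 1 x - H x))"
    unfolding card_class by (rule sum.cong) (simp_all only: ind_2)
  also have "\<dots> = 3 * (N\<^sup>2 - N) / 8"
    unfolding sum_distrib_left[symmetric] sum.distrib sum_subtractf sum_H
    by (simp add: sum_phi F_one card_V)
  finally show ?thesis .
qed

lemma card_class_3: "real (card {x \<in> V. cls x = 3}) = t * (N - 1)"
proof -
  have "(\<Sum>x\<in>V. \<Sum>j<m. line (\<kappa> j) x) = (\<Sum>j<m. \<Sum>x\<in>V. line (\<kappa> j) x)" by (rule sum.swap)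
  also have "\<dots> = m * N" by (simp add: sum_line_1 kappa_mem)
  finally have lines: "(\<Sum>x\<in>V. \<Sum>j<m. line (\<kappa> j) x) = m * N" .
  have delta: "(\<Sum>x\<in>V. of_bool (x = 0) :: real) = 1"
    using finite_V zero_mem by (simp add: of_bool_def)
  have "real (card {x \<in> V. cls x = 3}) = (\<Sum>x\<in>V. 1 / 2 + (1 / 2) * \<phi> 1 x +
      (real m - 1) * of_bool (x = 0) - (\<Sum>j<m. line (\<kappa> j) x))"
    unfolding card_class by (rule sum.cong) (simp_all only: ind_3)
  also have "\<dots> = N\<^sup>2 / 2 + N / 2 + (real m - 1) - m * N"
    unfolding sum_subtractf sum.distrib sum_distrib_left[symmetric] lines delta
    by (simp add: sum_phi F_one card_V)
  also have "\<dots> = t * (N - 1)"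
    by (simp add: t_eq field_simps power2_eq_square)
  finally show ?thesis .
qed

lemma N_squared_gt: "N\<^sup>2 > N" using N_ge_4 by (simp add: power2_eq_square)

lemma class_witness:
  assumes "i \<le> m + 3"
  shows "\<exists>x\<in>V. cls x = i"
proof -
  have nonempty: "\<exists>x\<in>V. cls x = k" if "real (card {x \<in> V. cls x = k}) > 0" for k
  proof -
    have "card {x \<in> V. cls x = k} \<noteq> 0" using that by simp
    then have "{x \<in> V. cls x = k} \<noteq> {}" by (metis card.empty)
    then show ?thesis by blast
  qed
  show ?thesis
  proof (cases i rule: less_4_cases)
    case 1
    then show ?thesis using zero_mem by (auto simp: cls_eq_0_iff)
  next
    case 2
    show ?thesis unfolding 2 by (rule nonempty) (use N_squared_gt in \<open>simp only: card_class_1\<close>, simp)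
  next
    case 3
    show ?thesis unfolding 3 by (rule nonempty) (use N_squared_gt in \<open>simp only: card_class_2\<close>, simp)
  next
    case 4
    show ?thesis unfolding 4
      by (rule nonempty) (use N_ge_4 t_pos in \<open>simp only: card_class_3\<close>, simp)
  next
    case 5
    define j where "j = i - 4"
    have j: "i = 4 + j" "j < m" using 5 assms by (auto simp: j_def)
    have "(1, 0, \<kappa> j, 0) \<in> V" "on_line (\<kappa> j) (1, 0, \<kappa> j, 0)"
      by (simp_all add: V_def F_closed kappa_mem j)
    then show ?thesis using cls_line[of "(1, 0, \<kappa> j, 0)" j] j by (force simp: zero_prod_def)
  qed
qed

definition rel :: "nat \<Rightarrow> real mat" where
  "rel i = cayley (\<lambda>x. of_bool (cls x = i))"

lemma rel_scheme: "assoc_scheme (m + 3) (card V) rel"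
  unfolding rel_def
proof (rule cayley_scheme)
  show "cls ` V = {..m + 3}"
    using class_witness cls_range by (auto simp: image_def)
  show "class_function cls (conv f g)" if "class_function cls f" "class_function cls g" for f g
    by (rule conv_closed_if_spanning[OF basis_spans basis_table that])
qed (simp add: cls_eq_0_iff)

text \<open>The function \<open>e\<close> stands for \<open>1\<^sub>D + t' \<delta>\<^sub>0\<close> in whatever form makes its convolution square computable.\<close>

lemma latin_class:
  fixes t' :: nat and c :: real
  assumes i: "i \<noteq> 0" "i \<le> m + 3" and t': "t' > 0"
    and card: "real (card {x \<in> V. cls x = i}) = t' * (N - 1)"
    and square: "\<And>z. z \<in> V \<Longrightarrow> conv e e z = N * e z + c"
    and e: "\<And>x. x \<in> V \<Longrightarrow> of_bool (cls x = i) + real t' * of_bool (x = 0) = e x"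
  shows "latin_square_type (card V) (rel i)"
proof -
  define D where "D = {x \<in> V. cls x = i}"
  have D: "x \<in> V \<Longrightarrow> of_bool (cls x = i) = of_bool (x \<in> D)" for x by (simp add: D_def)
  have "rel i = cayley (\<lambda>x. of_bool (x \<in> D))"
    unfolding rel_def by (rule cayley_cong) (rule D)
  moreover have "latin_square_type (card V) (cayley (\<lambda>x. of_bool (x \<in> D)))"
  proof (rule latin_square_type_cayley)
    show "D \<subseteq> V" "0 \<notin> D" using i cls_eq_0_iff[of 0] by (auto simp: D_def)
    show "D \<noteq> {}" using class_witness[OF i(2)] by (auto simp: D_def)
    have "\<exists>k. k \<noteq> i \<and> k \<noteq> 0 \<and> k \<le> m + 3" by (rule exI[of _ "if i = 1 then 2 else 1"]) auto
    then obtain k x where "k \<noteq> i" "k \<noteq> 0" "x \<in> V" "cls x = k" using class_witness by blast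
    then have "x \<noteq> 0" "x \<notin> D" using cls_0 by (auto simp: D_def)
    then show "insert 0 D \<noteq> V" using \<open>x \<in> V\<close> by blast
    show "card V = (q\<^sup>2)\<^sup>2" by (simp add: V_def q_def card_cartesian_product power2_eq_square)
    show "q\<^sup>2 > 0" using q_pos by simp
    have "real (q\<^sup>2 - 1) = N - 1" using q_pos by (simp add: N_def of_nat_diff Suc_le_eq)
    then have "real (card D) = real (t' * (q\<^sup>2 - 1))" using card by (simp add: D_def)
    then show "card D = t' * (q\<^sup>2 - 1)" by (simp only: of_nat_eq_iff)
    have *: "of_bool (x \<in> D) + real t' * of_bool (x = 0) = e x" if "x \<in> V" for x
      using e[OF that] that by (simp add: D_def)
    fix z assume z: "z \<in> V"
    have "conv (\<lambda>x. of_bool (x \<in> D) + real t' * of_bool (x = 0))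
        (\<lambda>x. of_bool (x \<in> D) + real t' * of_bool (x = 0)) z = conv e e z"
      by (rule conv_cong) (simp_all only: * z)
    then show "conv (\<lambda>x. of_bool (x \<in> D) + real t' * of_bool (x = 0))
        (\<lambda>x. of_bool (x \<in> D) + real t' * of_bool (x = 0)) z =
        real (q\<^sup>2) * (of_bool (z \<in> D) + real t' * of_bool (z = 0)) + c"
      using square[OF z] *[OF z] by (simp add: N_def)
  qed (rule t')
  ultimately show ?thesis by simp
qed

lemma latin_line:
  assumes j: "j < m"
  shows "latin_square_type (card V) (rel (4 + j))"
proof (rule latin_class[where e = "line (\<kappa> j)" and t' = 1 and c = 0])
  have split: "of_bool (cls x = 4 + j) = line (\<kappa> j) x - of_bool (x = 0)" if "x \<in> V" for x
    using line_cls[OF j, of x] cls_eq_0_iff[of x] by (auto simp: of_bool_def)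
  then show "of_bool (cls x = 4 + j) + real 1 * of_bool (x = 0) = line (\<kappa> j) x" if "x \<in> V" for x
    using that by simp
  have "real (card {x \<in> V. cls x = 4 + j}) = (\<Sum>x\<in>V. line (\<kappa> j) x - of_bool (x = 0))"
    unfolding card_class by (rule sum.cong) (simp_all only: split)
  then show "real (card {x \<in> V. cls x = 4 + j}) = real 1 * (N - 1)"
    using finite_V zero_mem by (simp add: sum_subtractf sum_line_1 kappa_mem j of_bool_def)
qed (use j in \<open>simp_all add: conv_line_self kappa_mem\<close>)

text \<open>The functions \<open>(\<phi>\<^sub>1 + N \<delta>\<^sub>0) / 2\<close> and the lines all satisfy \<open>g * g = N g\<close>. The product of the former with
a line is \<open>N\<close> times the line, and products of different lines are constant. Hence
\<open>g * g = N g\<close> holds up to constants also for the former minus the sum of the lines, which is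
\<open>1\<^sub>D + t \<delta>\<^sub>0\<close> for the class \<open>D\<close> with number 3, up to a constant.\<close>

lemma latin_rest: "latin_square_type (card V) (rel 3)"
proof -
  \<comment> \<open>The computation is done with \<open>2 e\<close> to avoid fractions.\<close>
  define f where "f x = 1 + \<phi> 1 x + N * of_bool (x = 0) - 2 * (\<Sum>j<m. line (\<kappa> j) x)" for x
  define e where "e x = (1 / 2) * f x" for x
  define c where "c = (N\<^sup>2 + 2 * N - 4 * m * N + 4 * (m * (real m - 1))) / 4"
  have c4: "4 * c = N\<^sup>2 + 2 * N - 4 * m * N + 4 * (m * (real m - 1))"
    by (simp add: c_def)
  have line_lines: "(\<Sum>j<m. conv (line (\<kappa> i)) (line (\<kappa> j)) z) = N * line (\<kappa> i) z + (real m - 1)"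
    if "i < m" "z \<in> V" for i z
  proof -
    have "(\<Sum>j<m. conv (line (\<kappa> i)) (line (\<kappa> j)) z) =
        (\<Sum>j<m. (if j = i then N * line (\<kappa> i) z - 1 else 0) + 1)"
      using that by (intro sum.cong) (auto simp: conv_line_self conv_line_line kappa_mem kappa_eq_iff)
    then show ?thesis using that by (simp add: sum.distrib)
  qed
  have phi_line: "conv (\<phi> 1) (line (\<kappa> j)) z = N * line (\<kappa> j) z"
    and line_phi: "conv (line (\<kappa> j)) (\<phi> 1) z = N * line (\<kappa> j) z" if "j < m" "z \<in> V" for j z
    using conv_commute[OF that(2)] conv_line_phi[OF kappa_mem[OF that(1)] F_one one_neq_zero that(2)] by metis+
  have "conv e e z = N * e z + c" if z: "z \<in> V" for z
  proof -
    have delta: "(\<Sum>x\<in>V. of_bool (x = 0) :: real) = 1"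
      using finite_V zero_mem by (simp add: of_bool_def)
    define S where "S = (\<Sum>j<m. line (\<kappa> j) z)"
    have lines: "(\<Sum>j<m. conv (\<phi> 1) (line (\<kappa> j)) z) = N * S" "(\<Sum>j<m. conv (line (\<kappa> j)) (\<phi> 1) z) = N * S"
      "(\<Sum>i<m. \<Sum>j<m. conv (line (\<kappa> i)) (line (\<kappa> j)) z) = N * S + m * (real m - 1)"
      "(\<Sum>j<m. 1 * (\<Sum>y\<in>V. line (\<kappa> j) y)) = m * N"
      by (simp_all add: S_def phi_line line_phi line_lines z sum_distrib_left sum.distrib sum_line_1 kappa_mem)
    have "conv f f z = 2 * N * f z + 4 * c"
      unfolding f_def[abs_def] conv_linear conv_const_right conv_const_left[OF z]
        conv_delta_left conv_delta_right[OF z] conv_phi_self[OF F_one one_neq_zero z] lines delta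
        sum_phi[OF F_one one_neq_zero] S_def[symmetric] c4
      by (simp add: card_V power2_eq_square algebra_simps)
    then show ?thesis
      unfolding e_def[abs_def] conv_linear by simp
  qed
  then show ?thesis
  proof (rule latin_class[where e = e and t' = t and c = c, rotated -2])
    show "of_bool (cls x = 3) + real t * of_bool (x = 0) = e x" if "x \<in> V" for x
      by (simp add: ind_3[OF that] e_def f_def t_eq algebra_simps)
  qed (use t_pos card_class_3 in simp_all)
qed

lemma not_latin:
  assumes x: "x \<in> V" "x \<noteq> 0" "cls x \<noteq> i" and y: "y \<in> V" "y \<noteq> 0" "cls y \<noteq> i"
    and f: "\<And>x. x \<in> V \<Longrightarrow> of_bool (cls x = i) = (1 / 8) * f x"
    and neq: "conv f f x \<noteq> conv f f y"
  shows "\<not> latin_square_type (card V) (rel i)"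
proof
  assume "latin_square_type (card V) (rel i)"
  then obtain A where srg: "strongly_regular_in (card V) A (rel i)"
    by (auto simp: latin_square_type_def)
  have "rel i = cayley (\<lambda>x. (1 / 8) * f x)"
    unfolding rel_def by (rule cayley_cong) (rule f)
  then have "conv (\<lambda>x. (1 / 8) * f x) (\<lambda>x. (1 / 8) * f x) x = conv (\<lambda>x. (1 / 8) * f x) (\<lambda>x. (1 / 8) * f x) y"
    using srg x y f[OF x(1)] f[OF y(1)]
    by (intro strongly_regular_conv_eq[where A = A]) auto
  then show False using neq unfolding conv_linear by simp
qed

lemma not_latin_1: "\<not> latin_square_type (card V) (rel 1)"
proof -
  obtain x y where x: "x \<in> V" "cls x = 2" and y: "y \<in> V" "cls y = 3"
    using class_witness[of 2] class_witness[of 3] by auto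
  have nz: "x \<noteq> 0" "y \<noteq> 0" using x y cls_0 by auto
  define f where "f z = H z - \<phi> 1 z + 1" for z
  have "conv f f z = - 2 * N * H z - 6 * N * \<phi> 1 z + (N\<^sup>2 - 2 * N)" if z: "z \<in> V" "z \<noteq> 0" for z
    unfolding f_def[abs_def] conv_linear conv_const_right conv_const_left[OF z(1)] conv_phi_1_H[OF z(1)]
      trans[OF conv_commute[OF z(1)] conv_phi_1_H[OF z(1)]] conv_H_H[OF z(1)]
      conv_phi_self[OF F_one one_neq_zero z(1)] sum_phi[OF F_one one_neq_zero] sum_H
    using z by (simp add: card_V algebra_simps)
  then have "conv f f x \<noteq> conv f f y"
    using x y nz N_pos by (simp add: H_cls phi_1_cls)
  then show ?thesis
    by (rule not_latin[rotated -1]) (use x y nz in \<open>simp_all add: f_def H_cls phi_1_cls\<close>)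
qed

lemma not_latin_2: "\<not> latin_square_type (card V) (rel 2)"
proof -
  obtain x y where x: "x \<in> V" "cls x = 1" and y: "y \<in> V" "cls y = 3"
    using class_witness[of 1] class_witness[of 3] by auto
  have nz: "x \<noteq> 0" "y \<noteq> 0" using x y cls_0 by auto
  define f where "f z = 3 - 3 * \<phi> 1 z - H z" for z
  have "conv f f z = - 10 * N * H z - 6 * N * \<phi> 1 z + (9 * N\<^sup>2 - 18 * N)" if z: "z \<in> V" "z \<noteq> 0" for z
    unfolding f_def[abs_def] conv_linear conv_const_right conv_const_left[OF z(1)] conv_phi_1_H[OF z(1)]
      trans[OF conv_commute[OF z(1)] conv_phi_1_H[OF z(1)]] conv_H_H[OF z(1)]
      conv_phi_self[OF F_one one_neq_zero z(1)] sum_phi[OF F_one one_neq_zero] sum_H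
    using z by (simp add: card_V algebra_simps)
  then have "conv f f x \<noteq> conv f f y"
    using x y nz N_pos by (simp add: H_cls phi_1_cls)
  then show ?thesis
    by (rule not_latin[rotated -1]) (use x y nz in \<open>simp_all add: f_def H_cls phi_1_cls\<close>)
qed

theorem latin_relations: "{i \<in> {1..m + 3}. latin_square_type (card V) (rel i)} = {3..m + 3}"
proof -
  have "latin_square_type (card V) (rel i) \<longleftrightarrow> 3 \<le> i" if "1 \<le> i" "i \<le> m + 3" for i
  proof -
    consider "i = 1" | "i = 2" | "i = 3" | j where "i = 4 + j" "j < m"
    proof -
      have "i < m + 4" "i \<noteq> 0" using \<open>1 \<le> i\<close> \<open>i \<le> m + 3\<close> by simp_all
      then show ?thesis using index_cases[of i] that by blast
    qed
    then show ?thesis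
      by cases (simp_all only: not_latin_1 not_latin_2 latin_rest latin_line, simp_all)
  qed
  then show ?thesis by auto
qed

end

section \<open>Finite fields of characteristic 2\<close>

lemma one_add_one_alg_closure_bit: "(1 :: bit alg_closure) + 1 = 0"
proof -
  have "to_ac (1 + 1 :: bit) = (1 :: bit alg_closure) + 1" by (simp only: to_ac_add to_ac_1)
  then show ?thesis by simp
qed

context
  assumes char_2: "(1 :: 'a :: alg_closed_field) + 1 = 0"
begin

lemma two_eq_0: "(2 :: 'a) = 0"
  using char_2 by simp

lemma add_self_0: "x + x = (0 :: 'a)"
  using two_eq_0 by (metis mult_2 mult_zero_left)

lemma add_square: "(x + y)\<^sup>2 = x\<^sup>2 + (y :: 'a)\<^sup>2"
  by (simp add: power2_sum two_eq_0)

lemma add_power_2_power: "(x + y) ^ (2 ^ i) = x ^ (2 ^ i) + (y :: 'a) ^ (2 ^ i)"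
  by (induction i) (simp_all add: power_Suc2 power_mult add_square del: power_Suc)

definition galois_field :: "nat \<Rightarrow> 'a set" where
  "galois_field k = {x. x ^ (2 ^ k) = x}"

text \<open>The derivative of \<open>X\<^bsup>2^k\<^esup> - X\<close> is the constant \<open>-1\<close>, so the polynomial has no multiple roots.\<close>

lemma card_galois_field:
  assumes k: "k > 0"
  shows "finite (galois_field k)" "card (galois_field k) = 2 ^ k"
proof -
  define p :: "'a poly" where "p = monom 1 (2 ^ k) + [:0, - 1:]"
  have "(2 :: nat) ^ 1 \<le> 2 ^ k" using k by (intro power_increasing) auto
  then have deg: "degree p = 2 ^ k"
    unfolding p_def by (subst degree_add_eq_left) (simp_all add: degree_monom_eq)
  then have p0: "p \<noteq> 0" by auto
  have "poly p x = 0 \<longleftrightarrow> x \<in> galois_field k" for x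
    by (simp add: p_def poly_monom galois_field_def)
  then have roots: "galois_field k = {x. poly p x = 0}" by blast
  show fin: "finite (galois_field k)" unfolding roots by (rule poly_roots_finite[OF p0])
  obtain A where A: "size A = degree p" "p = smult (lead_coeff p) (\<Prod>x\<in>#A. [:-x, 1:])"
    using alg_closed_imp_factorization[OF p0] by blast
  have "of_nat (2 ^ k) = (0 :: 'a)"
    using k by (simp add: two_eq_0)
  then have deriv: "pderiv p = [:- 1:]"
    by (simp add: p_def pderiv_add pderiv_monom pderiv_pCons)
  have simple: "count A x \<le> 1" for x
  proof (rule ccontr)
    assume "\<not> count A x \<le> 1"
    then have "2 \<le> count A x" by simp
    then have "replicate_mset 2 x \<subseteq># A" by (simp only: count_le_replicate_mset_subset_eq)
    then obtain B where "A = {#x, x#} + B"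
      by (auto simp: mset_subset_eq_exists_conv numeral_2_eq_2)
    then have "p = [:-x, 1:] * ([:-x, 1:] * smult (lead_coeff p) (\<Prod>y\<in>#B. [:-y, 1:]))"
      using A(2) by simp
    then obtain r where r: "p = [:-x, 1:] * ([:-x, 1:] * r)" by blast
    have "poly (pderiv p) x = 0"
      unfolding r by (simp only: pderiv_mult poly_add poly_mult) simp
    then show False by (simp add: deriv)
  qed
  have "set_mset A \<subseteq> galois_field k"
  proof
    fix x assume "x \<in># A"
    then obtain B where "A = add_mset x B" by (metis mset_add)
    then have "p = [:-x, 1:] * smult (lead_coeff p) (\<Prod>y\<in>#B. [:-y, 1:])" using A(2) by simp
    then obtain r where r: "p = [:-x, 1:] * r" by blast
    have "poly p x = 0" unfolding r by simp
    then show "x \<in> galois_field k" by (simp add: roots)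
  qed
  then have "card (set_mset A) \<le> card (galois_field k)" by (rule card_mono[OF fin])
  moreover have "size A = card (set_mset A)"
  proof -
    have "size A = (\<Sum>x\<in>set_mset A. count A x)" by (rule size_multiset_overloaded_eq)
    also have "\<dots> = (\<Sum>x\<in>set_mset A. 1)"
      by (rule sum.cong[OF refl]) (metis simple antisym_conv count_greater_eq_one_iff)
    finally show ?thesis by simp
  qed
  moreover have "card (galois_field k) \<le> degree p"
    unfolding roots by (rule card_poly_roots_bound[OF p0])
  ultimately show "card (galois_field k) = 2 ^ k" using A(1) deg by simp
qed

lemma galois_field_closed:
  "0 \<in> galois_field k" "1 \<in> galois_field k"
  "x \<in> galois_field k \<Longrightarrow> y \<in> galois_field k \<Longrightarrow> x + y \<in> galois_field k"
  "x \<in> galois_field k \<Longrightarrow> y \<in> galois_field k \<Longrightarrow> x * y \<in> galois_field k"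
  "x \<in> galois_field k \<Longrightarrow> inverse x \<in> galois_field k"
  by (simp_all add: galois_field_def add_power_2_power power_mult_distrib power_inverse)

text \<open>Every root of \<open>x\<^sup>3 = x + 1\<close> satisfies \<open>x\<^sup>8 = x\<close>, so it lies in all fields of order \<open>8\<^sup>j\<close>.\<close>

lemma octic_root:
  obtains \<alpha> :: 'a where "\<alpha> ^ 3 = \<alpha> + 1" "\<And>j. \<alpha> \<in> galois_field (3 * j)"
proof -
  have "degree [:1, 1, 0, 1 :: 'a:] = 3" by simp
  then obtain \<alpha> :: 'a where "poly [:1, 1, 0, 1:] \<alpha> = 0"
    using alg_closed_imp_poly_has_root[of "[:1, 1, 0, 1 :: 'a:]"] by auto
  then have "\<alpha> ^ 3 + (\<alpha> + 1) = 0" by (simp add: power3_eq_cube algebra_simps)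
  then have cube: "\<alpha> ^ 3 = \<alpha> + 1" by (metis add_self_0 add_right_cancel)
  have "\<alpha> ^ 8 = (\<alpha> ^ 3)\<^sup>2 * \<alpha>\<^sup>2" by (simp add: power_mult[symmetric] power_add[symmetric])
  also have "(\<alpha> ^ 3)\<^sup>2 = \<alpha>\<^sup>2 + 1" by (simp add: cube add_square)
  also have "(\<alpha>\<^sup>2 + 1) * \<alpha>\<^sup>2 = \<alpha> * \<alpha> ^ 3 + \<alpha>\<^sup>2"
    by (simp add: power2_eq_square power3_eq_cube algebra_simps)
  also have "\<dots> = \<alpha> + (\<alpha>\<^sup>2 + \<alpha>\<^sup>2)" by (simp add: cube power2_eq_square algebra_simps)
  finally have eight: "\<alpha> ^ 8 = \<alpha>" by (simp add: add_self_0)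
  have "\<alpha> ^ (8 ^ j) = \<alpha>" for j by (induction j) (simp_all add: power_mult eight)
  then have "\<alpha> \<in> galois_field (3 * j)" for j by (simp add: galois_field_def power_mult)
  then show ?thesis using that cube by blast
qed

definition field_trace :: "nat \<Rightarrow> 'a \<Rightarrow> 'a" where
  "field_trace k x = (\<Sum>i<k. x ^ (2 ^ i))"

lemma field_trace_add: "field_trace k (x + y) = field_trace k x + field_trace k y"
  by (simp add: field_trace_def add_power_2_power sum.distrib)

lemma square_sum: "(\<Sum>i\<in>I. f i)\<^sup>2 = (\<Sum>i\<in>I. (f i :: 'a)\<^sup>2)"
  by (induction I rule: infinite_finite_induct) (simp_all add: add_square)

text \<open>Squaring permutes the summands of the trace, so the trace equals its own square.\<close>

lemma field_trace_range:
  assumes x: "x \<in> galois_field k"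
  shows "field_trace k x = 0 \<or> field_trace k x = 1"
proof -
  have "(field_trace k x)\<^sup>2 = (\<Sum>i<k. x ^ (2 ^ Suc i))"
    by (simp add: field_trace_def square_sum power_mult[symmetric] mult.commute)
  also have "\<dots> + x = field_trace k x + x ^ (2 ^ k)"
    using sum.lessThan_Suc_shift[of "\<lambda>i. x ^ (2 ^ i)" k] by (simp add: field_trace_def add.commute)
  finally have "(field_trace k x)\<^sup>2 = field_trace k x"
    using x by (simp add: galois_field_def)
  then show ?thesis by (simp add: power2_eq_square)
qed

text \<open>As a polynomial the trace has degree \<open>2\<^bsup>k-1\<^esup>\<close>, too small to vanish on all \<open>2\<^sup>k\<close> elements.\<close>

lemma field_trace_nontrivial:
  assumes k: "k > 0"
  shows "\<exists>x\<in>galois_field k. field_trace k x \<noteq> 0"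
proof (rule ccontr)
  assume *: "\<not> ?thesis"
  define p :: "'a poly" where "p = (\<Sum>i<k. monom 1 (2 ^ i))"
  have "coeff p 1 = (\<Sum>i<k. if i = 0 then 1 else 0)"
    unfolding p_def coeff_sum by (rule sum.cong) auto
  then have p0: "p \<noteq> 0" using k by auto
  have "degree p \<le> 2 ^ (k - 1)"
    unfolding p_def by (rule degree_sum_le) (auto simp: degree_monom_eq intro!: power_increasing)
  moreover have "galois_field k \<subseteq> {x. poly p x = 0}"
    using * by (auto simp: p_def poly_sum poly_monom field_trace_def)
  then have "card (galois_field k) \<le> card {x. poly p x = 0}"
    by (intro card_mono poly_roots_finite[OF p0])
  ultimately have "(2 :: nat) ^ k \<le> 2 ^ (k - 1)"
    using card_poly_roots_bound[OF p0] card_galois_field[OF k] by linarith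
  then show False using k by simp
qed

end

section \<open>Existence for every number of classes\<close>

lemma not_latin_square_type_8: "\<not> latin_square_type 8 M"
proof
  assume "latin_square_type 8 M"
  then obtain n :: nat where n: "8 = n * n"
    by (auto simp: latin_square_type_def power2_eq_square)
  show False
  proof (cases "n \<le> 2")
    case True
    from mult_le_mono[OF True True] show False using n by simp
  next
    case False
    then have "3 \<le> n" by simp
    from mult_le_mono[OF this this] show False using n by simp
  qed
qed

lemma two_class_case: "\<exists>A. assoc_scheme 2 8 A"
proof -
  define V :: "(bit \<times> bit \<times> bit) set" where "V = UNIV"
  have UNIV_bit: "(UNIV :: bit set) = {0, 1}"
    using bit_not_zero_iff by auto
  have "finite (UNIV :: bit set)" "card (UNIV :: bit set) = 2" by (simp_all add: UNIV_bit)
  then have fin: "finite V" and card: "card V = 8"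
    unfolding V_def UNIV_Times_UNIV[symmetric] by (simp_all only: finite_SigmaI card_cartesian_product)
  have double: "x + x = 0" for x :: "bit \<times> bit \<times> bit"
    by (cases x) (simp add: zero_prod_def)
  interpret boolean_group V
    by unfold_locales (use fin double in \<open>simp_all add: V_def\<close>)
  have "\<exists>A. assoc_scheme 2 (card V) A"
  proof (rule subgroup_scheme)
    show "{0, (1, 0, 0)} \<noteq> {0 :: bit \<times> bit \<times> bit}" by (simp add: zero_prod_def)
    show "{0, (1, 0, 0)} \<noteq> V"
    proof
      assume "{0, (1, 0, 0)} = V"
      then have "(0, 1, 0) \<in> {0 :: bit \<times> bit \<times> bit, (1, 0, 0)}" by (simp add: V_def)
      then show False by (simp add: zero_prod_def)
    qed
  qed (auto simp: V_def zero_prod_def)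
  then show ?thesis by (simp add: card)
qed

text \<open>The field of order \<open>8\<^bsup>m+1\<^esup>\<close> has more than \<open>m\<close> elements, and its absolute trace defines \<open>\<psi>\<close>.\<close>

lemma quadric_lines_exists: "\<exists>F \<alpha> \<psi> \<kappa>. quadric_lines (F :: bit alg_closure set) \<alpha> \<psi> m \<kappa>"
proof -
  note char_2 = one_add_one_alg_closure_bit
  define k where "k = 3 * Suc m"
  have k: "k > 0" by (simp add: k_def)
  define F :: "bit alg_closure set" where "F = galois_field k"
  define \<psi> where "\<psi> x = (if field_trace k x = 0 then 1 else - 1 :: real)" for x :: "bit alg_closure"
  obtain \<alpha> :: "bit alg_closure" where \<alpha>: "\<alpha> ^ 3 = \<alpha> + 1" "\<alpha> \<in> F"
    using octic_root[OF char_2] unfolding F_def k_def by metis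
  note field_trace = field_trace_range[OF char_2, of _ k, folded F_def]
  have psi_add: "\<psi> (x + y) = \<psi> x * \<psi> y" if "x \<in> F" "y \<in> F" for x y
    using field_trace[OF that(1)] field_trace[OF that(2)] char_2
    by (auto simp: \<psi>_def field_trace_add[OF char_2])
  have "m < 2 ^ m" by (rule less_exp)
  also have "(2 :: nat) ^ m \<le> 2 ^ k" by (rule power_increasing) (simp_all add: k_def)
  finally have m: "m \<le> card F" by (simp add: F_def card_galois_field[OF char_2 k])
  have fin: "finite F" unfolding F_def by (rule card_galois_field(1)[OF char_2 k])
  obtain \<kappa> where "bij_betw \<kappa> {0..<card F} F" using ex_bij_betw_nat_finite[OF fin] by blast
  then have "inj_on \<kappa> {..<m}" "\<And>j. j < m \<Longrightarrow> \<kappa> j \<in> F"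
    using m by (auto simp: bij_betw_def intro: inj_on_subset)
  then have "quadric_lines F \<alpha> \<psi> m \<kappa>"
    using fin char_2 \<alpha> psi_add field_trace_nontrivial[OF char_2 k] galois_field_closed[OF char_2, where k = k]
    unfolding quadric_lines_def quadric_setup_def quadric_lines_axioms_def
    by (auto simp: F_def \<psi>_def)
  then show ?thesis by blast
qed

theorem theorem5p1:
  fixes d :: nat
  assumes "d > 1"
  shows "\<exists>v A. assoc_scheme d v A \<and> card {i \<in> {1..d}. latin_square_type v (A i)} = d - 2"
proof (cases "d = 2")
  case True
  obtain A where A: "assoc_scheme 2 8 A" using two_class_case by blast
  have "card {i \<in> {1..2}. latin_square_type 8 (A i)} = 2 - 2"
    by (simp add: not_latin_square_type_8)
  then show ?thesis using A unfolding True by blast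
next
  case False
  define m where "m = d - 3"
  have d: "d = m + 3" using assms False by (simp add: m_def)
  obtain F :: "bit alg_closure set" and \<alpha> \<psi> \<kappa> where "quadric_lines F \<alpha> \<psi> m \<kappa>"
    using quadric_lines_exists by blast
  then interpret quadric_lines F \<alpha> \<psi> m \<kappa> .
  show ?thesis
    unfolding d using rel_scheme latin_relations by (intro exI[of _ "card V"] exI[of _ rel]) simp
qed

end
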